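(* Let $R$ be an Archimedean Riesz space with weak unit $e$. Then the map $m\colon R\to\mathrm{C}(\mathcal{B}(R))$, $f\mapsto m(f)$, is a Riesz space embedding (an injective linear lattice homomorphism).
   Context: An ideal of a Riesz space $R$ is a Riesz subspace $A$ such that $|g|\le|f|$, $f\in A$ imply $g\in A$. A band is an ideal $A$ such that whenever a subset of $A$ has a supremum in $R$, that supremum lies in $A$. For Archimedean $R$, the set $\mathcal{B}(R)$ of bands ordered by inclusion is a complete Boolean algebra (hence a frame), with meets given by intersection. $[f]$ is the band generated by $f$. A weak unit is an element $e>0$ with $[e]=R$. The frame of reals $\mathfrak{L}(\mathbb{R})$ is the frame presented by generators $(p,-)$ and $(-,p)$, $p\in\mathbb{Q}$, with relations $(p,-)\wedge(-,q)=0$ if $p\ge q$; $(p,-)\vee(-,q)=1$ if $p<q$; $(p,-)=\bigvee_{q>p}(q,-)$; $(-,p)=\bigvee_{q<p}(-,q)$; $\bigvee_p(p,-)=1$; $\bigvee_p(-,p)=1$. For a frame $L$, $\mathrm{C}(L)$ is the set of frame homomorphisms $\mathfrak{L}(\mathbb{R})\to L$, ordered by $f\le g$ iff $f(p,-)\le g(p,-)$ for all $p\in\mathbb{Q}$. It is an Archimedean Riesz space with $(f\vee g)(p,-)=f(p,-)\vee g(p,-)$, $(f\wedge g)(p,-)=f(p,-)\wedge g(p,-)$, $(f+g)(p,-)=\bigvee_{r\in\mathbb{Q}}f(r,-)\wedge g(p-r,-)$, $(f+g)(-,q)=\bigvee_{s\in\mathbb{Q}}f(-,s)\wedge g(-,q-s)$,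 $(-f)(p,-)=f(-,-p)$, $(-f)(-,q)=f(-q,-)$, and for $\lambda>0$ $(\lambda f)(p,-)=\bigvee\{f(r,-)\mid r\in\mathbb{Q},\lambda r>p\}$, $(\lambda f)(-,q)=\bigvee\{f(-,s)\mid s\in\mathbb{Q},\lambda s<q\}$. For $f\in R$, $m(f)\in\mathrm{C}(\mathcal{B}(R))$ is the function given by $m(f)(p,-)=\bigvee_{r>p}[(f-re)^+]$ and $m(f)(-,q)=\bigvee_{r<q}[(f-re)^+]^\ast$ for $p,q\in\mathbb{Q}$ ($r$ ranging over $\mathbb{Q}$), where $^\ast$ denotes complement in $\mathcal{B}(R)$. *)

theory Defs
  imports Complex_Main "HOL-Library.Lattice_Algebras" "HOL-Library.FSet"
begin

section \<open>Frames\<close>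

class frame = complete_lattice +
  assumes inf_Sup: "inf a (Sup B) = (SUP b\<in>B. inf a b)"
begin

lemma inf_SUP: "inf a (SUP i\<in>I. f i) = (SUP i\<in>I. inf a (f i))"
  by (simp add: inf_Sup image_image)

lemma SUP_inf: "inf (SUP i\<in>I. f i) a = (SUP i\<in>I. inf (f i) a)"
  by (simp add: inf_SUP inf.commute)

lemma inf_sup_distrib: "inf a (sup b c) = sup (inf a b) (inf a c)"
  using inf_Sup[of a "{b, c}"] by simp

end

subclass (in frame) distrib_lattice
  using distrib_imp1 inf_sup_distrib by unfold_locales blast

definition frame_hom :: "('k::frame \<Rightarrow> 'l::frame) \<Rightarrow> bool" where
  "frame_hom h \<longleftrightarrow> h top = top \<and> (\<forall>a b. h (inf a b) = inf (h a) (h b)) \<and> (\<forall>A. h (Sup A) = Sup (h ` A))"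


section \<open>Riesz spaces and bands\<close>

text \<open>The absolute value is no extra structure: the class fixes it to be \<open>\<bar>x\<bar> = sup x (- x)\<close>.\<close>

class riesz_space = ordered_real_vector + lattice_ab_group_add_abs

class archimedean_riesz_space = riesz_space +
  assumes archimedean: "0 \<le> x \<Longrightarrow> (\<And>n. real n *\<^sub>R x \<le> y) \<Longrightarrow> x = 0"

definition riesz_subspace :: "'a::riesz_space set \<Rightarrow> bool" where
  "riesz_subspace A \<longleftrightarrow> subspace A \<and> (\<forall>f\<in>A. \<forall>g\<in>A. sup f g \<in> A \<and> inf f g \<in> A)"

definition riesz_ideal :: "'a::riesz_space set \<Rightarrow> bool" where
  "riesz_ideal A \<longleftrightarrow> riesz_subspace A \<and> (\<forall>f\<in>A. \<forall>g. \<bar>g\<bar> \<le> \<bar>f\<bar> \<longrightarrow> g \<in> A)"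

definition is_supremum :: "'a::order set \<Rightarrow> 'a \<Rightarrow> bool" where
  "is_supremum S s \<longleftrightarrow> (\<forall>x\<in>S. x \<le> s) \<and> (\<forall>u. (\<forall>x\<in>S. x \<le> u) \<longrightarrow> s \<le> u)"

definition is_band :: "'a::riesz_space set \<Rightarrow> bool" where
  "is_band A \<longleftrightarrow> riesz_ideal A \<and> (\<forall>S s. S \<subseteq> A \<and> is_supremum S s \<longrightarrow> s \<in> A)"

definition disjoint_complement :: "'a::riesz_space set \<Rightarrow> 'a set" where
  "disjoint_complement A = {g. \<forall>f\<in>A. inf \<bar>g\<bar> \<bar>f\<bar> = 0}"

lemma scaleR_inf:
  fixes x y :: "'a::riesz_space"
  assumes "0 < r" shows "r *\<^sub>R inf x y = inf (r *\<^sub>R x) (r *\<^sub>R y)"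
proof (rule antisym)
  show "r *\<^sub>R inf x y \<le> inf (r *\<^sub>R x) (r *\<^sub>R y)"
    using assms by (simp add: scaleR_left_mono)
  let ?z = "inf (r *\<^sub>R x) (r *\<^sub>R y)"
  have "inverse r *\<^sub>R ?z \<le> inverse r *\<^sub>R r *\<^sub>R x" "inverse r *\<^sub>R ?z \<le> inverse r *\<^sub>R r *\<^sub>R y"
    using assms by (intro scaleR_left_mono; simp)+
  then have "inverse r *\<^sub>R ?z \<le> inf x y" using assms by simp
  then have "r *\<^sub>R inverse r *\<^sub>R ?z \<le> r *\<^sub>R inf x y"
    using assms by (intro scaleR_left_mono) auto
  then show "?z \<le> r *\<^sub>R inf x y" using assms by simp
qed

lemma riesz_abs_scaleR:
  fixes x :: "'a::riesz_space"
  shows "\<bar>r *\<^sub>R x\<bar> \<le> \<bar>r\<bar> *\<^sub>R \<bar>x\<bar>"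
proof -
  have le: "s *\<^sub>R y \<le> \<bar>s\<bar> *\<^sub>R \<bar>y\<bar>" for s and y :: 'a
  proof (cases "0 \<le> s")
    case True
    then show ?thesis by (simp add: scaleR_left_mono abs_ge_self)
  next
    case False
    then have "(- s) *\<^sub>R (- y) \<le> (- s) *\<^sub>R \<bar>y\<bar>" by (intro scaleR_left_mono abs_ge_minus_self) auto
    with False show ?thesis by simp
  qed
  show ?thesis
    using le[of r x] le[of r "- x"] by (simp add: abs_le_iff)
qed

lemma riesz_inf_add_le:
  fixes a b c :: "'a::riesz_space"
  assumes "0 \<le> a" "0 \<le> b" "0 \<le> c"
  shows "inf (a + b) c \<le> inf a c + inf b c"
proof -
  have "inf a c + inf b c = inf (inf (a + b) (a + c)) (inf (c + b) (c + c))"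
    by (simp add: add_inf_distrib_left add_inf_distrib_right inf.assoc inf.commute inf.left_commute)
  moreover have "c \<le> a + c" "c \<le> c + b" "c \<le> c + c" using assms by auto
  ultimately show ?thesis
    by (smt (verit, best) inf.coboundedI2 inf.cobounded1 le_inf_iff)
qed

lemma riesz_disjoint_add:
  fixes a b c :: "'a::riesz_space"
  assumes "0 \<le> a" "0 \<le> b" "0 \<le> c" "inf a c = 0" "inf b c = 0"
  shows "inf (a + b) c = 0"
  using riesz_inf_add_le[OF assms(1-3)] assms by (intro antisym) auto

lemma riesz_disjoint_scaleR:
  fixes a c :: "'a::riesz_space"
  assumes "0 \<le> a" "0 \<le> c" "inf a c = 0" "0 \<le> r"
  shows "inf (r *\<^sub>R a) c = 0"
proof (rule antisym)
  define k where "k = max r 1"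
  have "k > 0" by (simp add: k_def)
  have "r *\<^sub>R a \<le> k *\<^sub>R a" using assms by (intro scaleR_right_mono) (auto simp: k_def)
  moreover have "1 *\<^sub>R c \<le> k *\<^sub>R c" using assms by (intro scaleR_right_mono) (auto simp: k_def)
  ultimately have "inf (r *\<^sub>R a) c \<le> inf (k *\<^sub>R a) (k *\<^sub>R c)" by (intro inf_mono) auto
  also have "\<dots> = 0" using scaleR_inf[OF \<open>k > 0\<close>, of a c] assms by simp
  finally show "inf (r *\<^sub>R a) c \<le> 0" .
  show "0 \<le> inf (r *\<^sub>R a) c" using assms by (simp add: scaleR_nonneg_nonneg)
qed

lemma riesz_disjoint_mono:
  fixes a b c :: "'a::riesz_space"
  assumes "inf b c = 0" "0 \<le> a" "0 \<le> c" "a \<le> b"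
  shows "inf a c = 0"
proof (rule antisym)
  show "inf a c \<le> 0" using inf_mono[OF assms(4) order_refl, of c] assms(1) by simp
  show "0 \<le> inf a c" using assms(2,3) by simp
qed

lemma riesz_idealI:
  assumes "subspace A" and solid: "\<And>f g. f \<in> A \<Longrightarrow> \<bar>g\<bar> \<le> \<bar>f\<bar> \<Longrightarrow> g \<in> A"
  shows "riesz_ideal (A :: 'a::riesz_space set)"
proof -
  have abs: "\<bar>f\<bar> \<in> A" if "f \<in> A" for f using solid[OF that] by simp
  have "sup f g \<in> A \<and> inf f g \<in> A" if fg: "f \<in> A" "g \<in> A" for f g
  proof -
    have s: "\<bar>f\<bar> + \<bar>g\<bar> \<in> A" using abs fg assms(1) by (simp add: subspace_add)
    have *: "f \<le> \<bar>f\<bar> + \<bar>g\<bar>" "g \<le> \<bar>f\<bar> + \<bar>g\<bar>" "- f \<le> \<bar>f\<bar> + \<bar>g\<bar>" "- g \<le> \<bar>f\<bar> + \<bar>g\<bar>"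
      by (metis abs_ge_self abs_ge_minus_self abs_ge_zero add_increasing2 add_increasing)+
    have "\<bar>sup f g\<bar> \<le> \<bar>\<bar>f\<bar> + \<bar>g\<bar>\<bar>" "\<bar>inf f g\<bar> \<le> \<bar>\<bar>f\<bar> + \<bar>g\<bar>\<bar>"
      using * by (auto simp: abs_le_iff neg_sup_eq_inf neg_inf_eq_sup intro: le_infI1 le_infI2)
    then show ?thesis using solid[OF s] by blast
  qed
  then show ?thesis using assms by (auto simp: riesz_ideal_def riesz_subspace_def)
qed

lemma is_band_subspace: "is_band A \<Longrightarrow> subspace A"
  by (simp add: is_band_def riesz_ideal_def riesz_subspace_def)

lemma is_band_solid: "is_band A \<Longrightarrow> f \<in> A \<Longrightarrow> \<bar>g\<bar> \<le> \<bar>f\<bar> \<Longrightarrow> g \<in> A"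
  by (auto simp: is_band_def riesz_ideal_def)

lemma is_band_sup: "is_band A \<Longrightarrow> S \<subseteq> A \<Longrightarrow> is_supremum S s \<Longrightarrow> s \<in> A"
  by (auto simp: is_band_def)

lemma is_bandI:
  assumes "subspace A" "\<And>f g. f \<in> A \<Longrightarrow> \<bar>g\<bar> \<le> \<bar>f\<bar> \<Longrightarrow> g \<in> A"
    "\<And>S s. S \<subseteq> A \<Longrightarrow> is_supremum S s \<Longrightarrow> s \<in> A"
  shows "is_band A"
  using riesz_idealI[of A] assms by (auto simp: is_band_def)

lemma is_band_Inter: "(\<And>A. A \<in> \<A> \<Longrightarrow> is_band A) \<Longrightarrow> is_band (\<Inter>\<A>)"
proof (rule is_bandI)
  assume *: "\<And>A. A \<in> \<A> \<Longrightarrow> is_band A"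
  then show "subspace (\<Inter>\<A>)" by (intro subspace_Inter) (auto simp: is_band_subspace)
  show "g \<in> \<Inter>\<A>" if "f \<in> \<Inter>\<A>" "\<bar>g\<bar> \<le> \<bar>f\<bar>" for f g
    using that * is_band_solid by blast
  show "s \<in> \<Inter>\<A>" if "S \<subseteq> \<Inter>\<A>" "is_supremum S s" for S s
    using that * is_band_sup by (metis Inter_iff le_Inf_iff)
qed

lemma is_band_UNIV: "is_band UNIV"
  by (rule is_bandI) auto

lemma riesz_least_trivial:
  fixes s x :: "'a::riesz_space"
  assumes "\<And>x. s \<le> x" shows "x = 0"
proof -
  have "0 \<le> s" using assms[of "s + s"] by simp
  have "y \<le> 0" for y :: 'a using assms[of "s - y"] by simp
  from this[of x] this[of "- x"] show ?thesis by simp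
qed

lemma is_band_disjoint_complement: "is_band (disjoint_complement (A :: 'a::riesz_space set))"
proof (rule is_bandI)
  show "subspace (disjoint_complement A)"
    unfolding subspace_def
  proof (intro conjI ballI allI)
    show "0 \<in> disjoint_complement A" by (simp add: disjoint_complement_def inf_absorb1)
    fix x y r assume x: "x \<in> disjoint_complement A" 
    { assume y: "y \<in> disjoint_complement A"
      have "inf \<bar>x + y\<bar> \<bar>f\<bar> = 0" if "f \<in> A" for f
        by (rule riesz_disjoint_mono[OF riesz_disjoint_add[of "\<bar>x\<bar>" "\<bar>y\<bar>"]])
          (use x y that in \<open>auto simp: disjoint_complement_def abs_triangle_ineq\<close>)
      then show "x + y \<in> disjoint_complement A" by (simp add: disjoint_complement_def) }
    have "inf \<bar>r *\<^sub>R x\<bar> \<bar>f\<bar> = 0" if "f \<in> A" for f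
      by (rule riesz_disjoint_mono[OF riesz_disjoint_scaleR[of "\<bar>x\<bar>" _ "\<bar>r\<bar>"]])
        (use x that in \<open>auto simp: disjoint_complement_def riesz_abs_scaleR\<close>)
    then show "r *\<^sub>R x \<in> disjoint_complement A" by (simp add: disjoint_complement_def)
  qed
  show "g \<in> disjoint_complement A" if "f \<in> disjoint_complement A" "\<bar>g\<bar> \<le> \<bar>f\<bar>" for f g
    using that by (auto simp: disjoint_complement_def intro: riesz_disjoint_mono)
  show "s \<in> disjoint_complement A" if S: "S \<subseteq> disjoint_complement A" and s: "is_supremum S s" for S s
  proof (cases "S = {}")
    case True
    then have "s = 0" using s riesz_least_trivial[of s] by (simp add: is_supremum_def)
    then show ?thesis by (simp add: disjoint_complement_def inf_absorb1)
  next
    case False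
    then obtain s0 where s0: "s0 \<in> S" by blast
    have "inf \<bar>s\<bar> \<bar>f\<bar> = 0" if f: "f \<in> A" for f
    proof -
      have neg: "inf (pprt (- s)) \<bar>f\<bar> = 0"
      proof (rule riesz_disjoint_mono)
        show "inf \<bar>s0\<bar> \<bar>f\<bar> = 0" using S s0 f by (auto simp: disjoint_complement_def)
        have "- s \<le> \<bar>s0\<bar>"
          using s s0 by (meson abs_ge_minus_self is_supremum_def neg_le_iff_le order_trans)
        then show "pprt (- s) \<le> \<bar>s0\<bar>" by (simp add: pprt_def)
      qed auto
      define c where "c = inf (pprt s) \<bar>f\<bar>"
      have c: "0 \<le> c" "c \<le> pprt s" "c \<le> \<bar>f\<bar>" by (auto simp: c_def)
      have "x \<le> pprt s - c" if x: "x \<in> S" for x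
      proof -
        have "inf \<bar>x\<bar> \<bar>f\<bar> = 0" using S x f by (auto simp: disjoint_complement_def)
        then have "inf (pprt x) \<bar>f\<bar> = 0"
          by (rule riesz_disjoint_mono) (auto simp: pprt_def abs_ge_self)
        then have "inf (pprt x) c \<le> 0" using inf_mono[OF order_refl c(3), of "pprt x"] by simp
        then have "inf (pprt x) c = 0" using c(1) by (intro antisym) auto
        then have "pprt x + c = sup (pprt x) c" using add_eq_inf_sup[of "pprt x" c] by simp
        also have "\<dots> \<le> pprt s" using c s x by (simp add: is_supremum_def)
        finally have "pprt x \<le> pprt s - c" by (simp add: le_diff_eq)
        moreover have "x \<le> pprt x" by (simp add: pprt_def)
        ultimately show ?thesis by order
      qed
      then have "s \<le> pprt s - c" using s by (simp add: is_supremum_def)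
      then have "pprt s \<le> pprt s - c" using c by (simp add: pprt_def[of s])
      then have "c = 0" using c by (simp add: antisym)
      with neg have "inf (pprt s + pprt (- s)) \<bar>f\<bar> = 0"
        by (intro riesz_disjoint_add) (auto simp: c_def)
      then show ?thesis by (simp add: abs_prts pprt_neg)
    qed
    then show ?thesis by (simp add: disjoint_complement_def)
  qed
qed

lemma disjoint_complement_disjoint:
  assumes "x \<in> A" "x \<in> disjoint_complement A" shows "x = 0"
  using assms by (auto simp: disjoint_complement_def)

lemma disjoint_complement_double:
  fixes A :: "'a::archimedean_riesz_space set"
  assumes A: "is_band A"
  shows "disjoint_complement (disjoint_complement A) = A"
proof (rule antisym)
  show "A \<subseteq> disjoint_complement (disjoint_complement A)"
    by (auto simp: disjoint_complement_def inf.commute)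
  let ?D = "disjoint_complement (disjoint_complement A)"
  have pos: "u \<in> A" if u: "u \<in> ?D" "0 \<le> u" for u
  proof -
    define T where "T = {b \<in> A. 0 \<le> b \<and> b \<le> u}"
    have "u \<le> v" if v: "\<And>b. b \<in> T \<Longrightarrow> b \<le> v" for v
    proof -
      define z where "z = u - inf u v"
      have z0: "0 \<le> z" unfolding z_def by (metis diff_ge_0_iff_ge inf.cobounded1)
      have "0 \<in> T" using A u by (simp add: T_def is_band_subspace subspace_0)
      then have "0 \<le> inf u v" using v u by simp
      then have "z \<le> u" unfolding z_def by (metis diff_le_eq le_add_same_cancel1)
      then have zD: "z \<in> ?D"
        using is_band_solid[OF is_band_disjoint_complement u(1), of z] z0 u by simp
      have "z = 0"
      proof (rule ccontr)
        assume "z \<noteq> 0"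
        with zD have "z \<notin> disjoint_complement A" using disjoint_complement_disjoint by blast
        then obtain f where f: "f \<in> A" "inf \<bar>z\<bar> \<bar>f\<bar> \<noteq> 0" by (auto simp: disjoint_complement_def)
        define c where "c = inf \<bar>z\<bar> \<bar>f\<bar>"
        have c: "0 \<le> c" "c \<le> z" "c \<noteq> 0" using f z0 by (auto simp: c_def)
        have "\<bar>c\<bar> \<le> \<bar>f\<bar>" using c(1) by (simp add: c_def)
        then have cA: "c \<in> A" by (rule is_band_solid[OF A f(1)])
        have "real n *\<^sub>R c \<le> u" for n
        proof (induction n)
          case 0
          then show ?case using u by simp
        next
          case (Suc n)
          have "real n *\<^sub>R c \<in> T"
            using Suc cA c A by (simp add: T_def is_band_subspace subspace_scale scaleR_nonneg_nonneg)
          then have "real n *\<^sub>R c \<le> inf u v" using v Suc by simp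
          then have "real n *\<^sub>R c + c \<le> inf u v + z" using c by (intro add_mono)
          moreover have "inf u v + z = u" by (simp only: z_def add.commute[of "inf u v"] diff_add_cancel)
          ultimately show ?case by (simp add: algebra_simps)
        qed
        then show False using archimedean[of c u] c by blast
      qed
      then have "u = inf u v" unfolding z_def by (metis eq_iff_diff_eq_0)
      then show ?thesis by (metis inf.cobounded2)
    qed
    then have "is_supremum T u" by (auto simp: is_supremum_def T_def)
    then show "u \<in> A" using is_band_sup[OF A] by (metis (lifting) T_def mem_Collect_eq subsetI)
  qed
  show "?D \<subseteq> A"
  proof
    fix u assume "u \<in> ?D"
    then have "\<bar>u\<bar> \<in> ?D" using is_band_solid[OF is_band_disjoint_complement] by (metis abs_idempotent order_refl)
    then have "\<bar>u\<bar> \<in> A" by (simp add: pos)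
    then show "u \<in> A" using is_band_solid[OF A] by (metis abs_idempotent order_refl)
  qed
qed

lemma band_disjoint_iff:
  fixes A B :: "'a::riesz_space set"
  assumes A: "is_band A" and B: "is_band B"
  shows "A \<inter> B \<subseteq> {0} \<longleftrightarrow> A \<subseteq> disjoint_complement B"
proof
  assume *: "A \<inter> B \<subseteq> {0}"
  show "A \<subseteq> disjoint_complement B"
  proof
    fix a assume a: "a \<in> A"
    have "inf \<bar>a\<bar> \<bar>b\<bar> = 0" if b: "b \<in> B" for b
      using is_band_solid[OF A a, of "inf \<bar>a\<bar> \<bar>b\<bar>"] is_band_solid[OF B b, of "inf \<bar>a\<bar> \<bar>b\<bar>"] * by auto
    then show "a \<in> disjoint_complement B" by (simp add: disjoint_complement_def)
  qed
next
  assume "A \<subseteq> disjoint_complement B"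
  then show "A \<inter> B \<subseteq> {0}" using disjoint_complement_disjoint by blast
qed


typedef (overloaded) 'a band = "{A :: 'a::riesz_space set. is_band A}"
  morphisms band_set Abs_band
  using is_band_UNIV by blast

setup_lifting type_definition_band

lemma is_band_singleton0: "is_band {0 :: 'a::riesz_space}"
proof -
  have "disjoint_complement UNIV = {0 :: 'a}"
    using disjoint_complement_disjoint[OF UNIV_I] is_band_subspace[OF is_band_disjoint_complement]
    by (blast intro: subspace_0)
  then show ?thesis using is_band_disjoint_complement[of "UNIV :: 'a set"] by simp
qed

instantiation band :: (riesz_space) complete_lattice
begin

lift_definition less_eq_band :: "'a band \<Rightarrow> 'a band \<Rightarrow> bool" is "(\<subseteq>)" .
lift_definition less_band :: "'a band \<Rightarrow> 'a band \<Rightarrow> bool" is "(\<subset>)" .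
lift_definition top_band :: "'a band" is UNIV by (rule is_band_UNIV)
lift_definition bot_band :: "'a band" is "{0}" by (rule is_band_singleton0)
lift_definition inf_band :: "'a band \<Rightarrow> 'a band \<Rightarrow> 'a band" is "(\<inter>)"
  subgoal for A B using is_band_Inter[of "{A, B}"] by auto
  done
lift_definition Inf_band :: "'a band set \<Rightarrow> 'a band" is "Inter"
  using is_band_Inter by blast
definition Sup_band :: "'a band set \<Rightarrow> 'a band" where
  "Sup_band \<A> = Inf {B. \<forall>A\<in>\<A>. A \<le> B}"
definition sup_band :: "'a band \<Rightarrow> 'a band \<Rightarrow> 'a band" where
  "sup_band A B = Inf {C. A \<le> C \<and> B \<le> C}"

instance
proof
  fix x y z :: "'a band" and A' :: "'a band set"
  show "(x < y) = (x \<le> y \<and> \<not> y \<le> x)" by transfer auto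
  show "x \<le> x" by transfer auto
  show "x \<le> y \<Longrightarrow> y \<le> z \<Longrightarrow> x \<le> z" by transfer auto
  show as: "x \<le> y \<Longrightarrow> y \<le> x \<Longrightarrow> x = y" for x y :: "'a band" by transfer auto
  show "inf x y \<le> x" "inf x y \<le> y" by (transfer; auto)+
  show "x \<le> y \<Longrightarrow> x \<le> z \<Longrightarrow> x \<le> inf y z" by transfer auto
  show l: "x \<in> A \<Longrightarrow> Inf A \<le> x" for x and A :: "'a band set" by transfer auto
  show g: "(\<And>x. x \<in> A \<Longrightarrow> z \<le> x) \<Longrightarrow> z \<le> Inf A" for z and A :: "'a band set" by transfer auto
  show "x \<in> A' \<Longrightarrow> x \<le> Sup A'" unfolding Sup_band_def by (rule g) auto
  show "(\<And>x. x \<in> A' \<Longrightarrow> x \<le> z) \<Longrightarrow> Sup A' \<le> z" unfolding Sup_band_def by (rule l) auto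
  show "x \<le> sup x y" "y \<le> sup x y" unfolding sup_band_def by (rule g; auto)+
  show "y \<le> x \<Longrightarrow> z \<le> x \<Longrightarrow> sup y z \<le> x" unfolding sup_band_def by (rule l) auto
  show "Inf {} = (top :: 'a band)" by transfer auto
  have "bot \<le> (B :: 'a band)" for B by transfer (auto simp: is_band_subspace subspace_0)
  then show "Sup {} = (bot :: 'a band)" unfolding Sup_band_def
    by (intro as l g) auto
qed

end

text \<open>
  For Archimedean spaces the disjoint complement is the Boolean complement; see the
  \<open>boolean_algebra\<close> instance below.
\<close>

instantiation band :: (riesz_space) "{uminus, minus}"
begin

lift_definition uminus_band :: "'a band \<Rightarrow> 'a band" is disjoint_complement
  by (rule is_band_disjoint_complement)
definition minus_band :: "'a band \<Rightarrow> 'a band \<Rightarrow> 'a band" where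
  "minus_band A B = inf A (- B)"

instance ..

end

lemma band_uminus_uminus [simp]: "- (- A) = (A :: 'a::archimedean_riesz_space band)"
  by transfer (rule disjoint_complement_double)

lemma band_inf_bot_iff: "inf A B = bot \<longleftrightarrow> A \<le> - (B :: 'a::riesz_space band)"
proof -
  have "inf A B = bot \<longleftrightarrow> inf A B \<le> bot" by (metis bot.extremum_unique)
  then show ?thesis by (simp, transfer) (rule band_disjoint_iff)
qed

instance band :: (archimedean_riesz_space) frame
proof
  fix A :: "'a band" and \<B> :: "'a band set"
  let ?C = "SUP B\<in>\<B>. inf A B"
  have "inf A B \<le> ?C" if "B \<in> \<B>" for B using that by (rule SUP_upper)
  then have "inf (inf A B) (- ?C) = bot" if "B \<in> \<B>" for B
    using that by (simp add: band_inf_bot_iff)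
  then have "B \<le> - inf A (- ?C)" if "B \<in> \<B>" for B
    using that by (simp only: band_inf_bot_iff[symmetric] inf.left_commute[of B A] inf.assoc)
  then have "Sup \<B> \<le> - inf A (- ?C)" by (rule Sup_least)
  then have "inf (inf A (Sup \<B>)) (- ?C) = bot"
    by (simp only: band_inf_bot_iff[symmetric] inf.left_commute[of "Sup \<B>" A] inf.assoc)
  then have "inf A (Sup \<B>) \<le> ?C" by (simp add: band_inf_bot_iff)
  moreover have "?C \<le> inf A (Sup \<B>)" by (intro SUP_least inf_mono Sup_upper order_refl)
  ultimately show "inf A (Sup \<B>) = ?C" by (rule antisym)
qed

instance band :: (archimedean_riesz_space) boolean_algebra
proof
  fix A B :: "'a band"
  show *: "inf A (- A) = bot" for A :: "'a band" by (simp add: band_inf_bot_iff)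
  have "- sup A (- A) \<le> inf (- A) (- (- A))"
    by (intro le_infI; subst band_inf_bot_iff[symmetric]; subst inf.commute; subst band_inf_bot_iff; simp)
  then have "- sup A (- A) = bot" by (metis * bot.extremum_unique)
  then have "top \<le> - (- sup A (- A))" by (simp add: band_inf_bot_iff[symmetric])
  then show "sup A (- A) = top" by (simp add: top_le)
  show "A - B = inf A (- B)" by (simp add: minus_band_def)
qed

lift_definition principal_band :: "'a::riesz_space \<Rightarrow> 'a band" is "\<lambda>f. \<Inter>{A. is_band A \<and> f \<in> A}"
  by (rule is_band_Inter) simp

definition weak_unit :: "'a::riesz_space \<Rightarrow> bool" where
  "weak_unit e \<longleftrightarrow> 0 < e \<and> principal_band e = top"


section \<open>The frame of reals\<close>

text \<open>The generators \<open>(p,-)\<close> and \<open>(-,p)\<close>.\<close>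

datatype real_gen = Gen_above rat | Gen_below rat

text \<open>
  A finite set of generators stands for its formal meet. \<open>real_rel F \<G>\<close> represents the defining
  inequality \<open>\<Sqinter>F \<le> \<Squnion>{\<Sqinter>G | G \<in> \<G>}\<close>; each defining equation is split into two inequalities,
  dropping those that hold in every frame.
\<close>

inductive real_rel :: "real_gen fset \<Rightarrow> real_gen fset set \<Rightarrow> bool" where
  "p \<ge> q \<Longrightarrow> real_rel {|Gen_above p, Gen_below q|} {}"
| "p < q \<Longrightarrow> real_rel {||} {{|Gen_above p|}, {|Gen_below q|}}"
| "real_rel {|Gen_above p|} ((\<lambda>q. {|Gen_above q|}) ` {q. q > p})"
| "q > p \<Longrightarrow> real_rel {|Gen_above q|} {{|Gen_above p|}}"
| "real_rel {|Gen_below p|} ((\<lambda>q. {|Gen_below q|}) ` {q. q < p})"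
| "q < p \<Longrightarrow> real_rel {|Gen_below q|} {{|Gen_below p|}}"
| "real_rel {||} (range (\<lambda>p. {|Gen_above p|}))"
| "real_rel {||} (range (\<lambda>p. {|Gen_below p|}))"

text \<open>
  The presented frame consists of the sets of formal meets that are closed under refinement and
  under the relations (stably under meets). That this is the frame presented by these
  generators and relations is the content of the lemmas \<open>satisfies_real_rels_above_below\<close> and
  \<open>real_frame_universal\<close> below.
\<close>

definition real_rel_ideal :: "real_gen fset set \<Rightarrow> bool" where
  "real_rel_ideal D \<longleftrightarrow>
     (\<forall>F\<in>D. \<forall>G. F |\<union>| G \<in> D) \<and>
     (\<forall>F \<G> H. real_rel F \<G> \<and> (\<forall>G\<in>\<G>. G |\<union>| H \<in> D) \<longrightarrow> F |\<union>| H \<in> D)"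

lemma real_rel_ideal_up: "real_rel_ideal D \<Longrightarrow> F \<in> D \<Longrightarrow> F |\<union>| G \<in> D"
  by (auto simp: real_rel_ideal_def)

lemma real_rel_ideal_cover:
  "real_rel_ideal D \<Longrightarrow> real_rel F \<G> \<Longrightarrow> (\<And>G. G \<in> \<G> \<Longrightarrow> G |\<union>| H \<in> D) \<Longrightarrow> F |\<union>| H \<in> D"
  unfolding real_rel_ideal_def by blast

lemma real_rel_ideal_Inter:
  assumes "\<And>D. D \<in> \<D> \<Longrightarrow> real_rel_ideal D"
  shows "real_rel_ideal (\<Inter>\<D>)"
  unfolding real_rel_ideal_def
proof (intro conjI ballI allI impI InterI)
  show "F |\<union>| G \<in> D" if "F \<in> \<Inter>\<D>" "D \<in> \<D>" for F G D
    using that real_rel_ideal_up[OF assms] by blast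
  show "F |\<union>| H \<in> D" if "real_rel F \<G> \<and> (\<forall>G\<in>\<G>. G |\<union>| H \<in> \<Inter>\<D>)" "D \<in> \<D>" for F \<G> H D
    using that by (intro real_rel_ideal_cover[OF assms, of D F \<G> H]) auto
qed

lemma real_rel_ideal_Int: "real_rel_ideal D \<Longrightarrow> real_rel_ideal E \<Longrightarrow> real_rel_ideal (D \<inter> E)"
  using real_rel_ideal_Inter[of "{D, E}"] by auto

lemma real_rel_ideal_imp:
  assumes "real_rel_ideal D"
  shows "real_rel_ideal {F. \<forall>G\<in>E. F |\<union>| G \<in> D}"
  unfolding real_rel_ideal_def
proof (intro conjI ballI allI impI CollectI)
  fix F G K assume "F \<in> {F. \<forall>G\<in>E. F |\<union>| G \<in> D}" "K \<in> E"
  then have "(F |\<union>| K) |\<union>| G \<in> D" using real_rel_ideal_up[OF assms] by blast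
  then show "F |\<union>| G |\<union>| K \<in> D" by (simp add: funion_ac)
next
  fix F \<G> H K
  assume *: "real_rel F \<G> \<and> (\<forall>G\<in>\<G>. G |\<union>| H \<in> {F. \<forall>G\<in>E. F |\<union>| G \<in> D})" and "K \<in> E"
  then have "F |\<union>| (H |\<union>| K) \<in> D"
    by (intro real_rel_ideal_cover[OF assms, of F \<G>]) (auto simp: funion_assoc)
  then show "F |\<union>| H |\<union>| K \<in> D" by (simp add: funion_ac)
qed

typedef real_frame = "{D. real_rel_ideal D}"
  morphisms real_frame_set Abs_real_frame
proof
  show "UNIV \<in> {D. real_rel_ideal D}" by (simp add: real_rel_ideal_def)
qed

setup_lifting type_definition_real_frame

instantiation real_frame :: complete_lattice
begin

lift_definition less_eq_real_frame :: "real_frame \<Rightarrow> real_frame \<Rightarrow> bool" is "(\<subseteq>)" .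
lift_definition less_real_frame :: "real_frame \<Rightarrow> real_frame \<Rightarrow> bool" is "(\<subset>)" .
lift_definition inf_real_frame :: "real_frame \<Rightarrow> real_frame \<Rightarrow> real_frame" is "(\<inter>)"
  by (rule real_rel_ideal_Int)
lift_definition Inf_real_frame :: "real_frame set \<Rightarrow> real_frame" is "Inter"
  using real_rel_ideal_Inter by blast
definition top_real_frame :: real_frame where "top_real_frame = Inf {}"
definition bot_real_frame :: real_frame where "bot_real_frame = Inf UNIV"
definition Sup_real_frame :: "real_frame set \<Rightarrow> real_frame" where
  "Sup_real_frame \<A> = Inf {B. \<forall>A\<in>\<A>. A \<le> B}"
definition sup_real_frame :: "real_frame \<Rightarrow> real_frame \<Rightarrow> real_frame" where
  "sup_real_frame A B = Inf {C. A \<le> C \<and> B \<le> C}"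

instance
proof
  fix x y z :: real_frame and A' :: "real_frame set"
  show "(x < y) = (x \<le> y \<and> \<not> y \<le> x)" by transfer auto
  show "x \<le> x" by transfer auto
  show "x \<le> y \<Longrightarrow> y \<le> z \<Longrightarrow> x \<le> z" by transfer auto
  show "x \<le> y \<Longrightarrow> y \<le> x \<Longrightarrow> x = y" by transfer auto
  show "inf x y \<le> x" "inf x y \<le> y" by (transfer; auto)+
  show "x \<le> y \<Longrightarrow> x \<le> z \<Longrightarrow> x \<le> inf y z" by transfer auto
  show l: "x \<in> A \<Longrightarrow> Inf A \<le> x" for x and A :: "real_frame set" by transfer auto
  show g: "(\<And>x. x \<in> A \<Longrightarrow> z \<le> x) \<Longrightarrow> z \<le> Inf A" for z and A :: "real_frame set" by transfer auto
  show "x \<in> A' \<Longrightarrow> x \<le> Sup A'" unfolding Sup_real_frame_def by (rule g) auto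
  show "(\<And>x. x \<in> A' \<Longrightarrow> x \<le> z) \<Longrightarrow> Sup A' \<le> z" unfolding Sup_real_frame_def by (rule l) auto
  show "x \<le> sup x y" "y \<le> sup x y" unfolding sup_real_frame_def by (rule g; auto)+
  show "y \<le> x \<Longrightarrow> z \<le> x \<Longrightarrow> sup y z \<le> x" unfolding sup_real_frame_def by (rule l) auto
  show "Inf {} = (top :: real_frame)" by (simp add: top_real_frame_def)
  show "Sup {} = (bot :: real_frame)" by (simp add: Sup_real_frame_def bot_real_frame_def)
qed

end

lift_definition real_frame_imp :: "real_frame \<Rightarrow> real_frame \<Rightarrow> real_frame"
  is "\<lambda>E D. {F. \<forall>G\<in>E. F |\<union>| G \<in> D}"
  by (rule real_rel_ideal_imp)

lemma real_frame_imp_iff: "A \<le> real_frame_imp B C \<longleftrightarrow> inf A B \<le> C"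
proof (transfer, rule)
  fix A B C :: "real_gen fset set"
  assume "A \<subseteq> {F. \<forall>G\<in>B. F |\<union>| G \<in> C}"
  then have "F |\<union>| F \<in> C" if "F \<in> A \<inter> B" for F using that by blast
  then show "A \<inter> B \<subseteq> C" by auto
next
  fix A B C :: "real_gen fset set"
  assume A: "real_rel_ideal A" and B: "real_rel_ideal B" and *: "A \<inter> B \<subseteq> C"
  have "F |\<union>| G \<in> C" if "F \<in> A" "G \<in> B" for F G
    using real_rel_ideal_up[OF A that(1), of G] real_rel_ideal_up[OF B that(2), of F] *
    by (auto simp: funion_commute)
  then show "A \<subseteq> {F. \<forall>G\<in>B. F |\<union>| G \<in> C}" by blast
qed

instance real_frame :: frame
proof
  fix A and \<B> :: "real_frame set"
  let ?C = "SUP B\<in>\<B>. inf A B"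
  have "inf B A \<le> ?C" if "B \<in> \<B>" for B using that by (subst inf.commute) (rule SUP_upper)
  then have "Sup \<B> \<le> real_frame_imp A ?C" by (intro Sup_least) (simp add: real_frame_imp_iff)
  then have "inf A (Sup \<B>) \<le> ?C" by (simp add: real_frame_imp_iff inf.commute)
  moreover have "?C \<le> inf A (Sup \<B>)" by (intro SUP_least inf_mono Sup_upper order_refl)
  ultimately show "inf A (Sup \<B>) = ?C" by (rule antisym)
qed

lift_definition real_frame_gen :: "real_gen \<Rightarrow> real_frame"
  is "\<lambda>x. \<Inter>{D. real_rel_ideal D \<and> {|x|} \<in> D}"
  by (rule real_rel_ideal_Inter) simp

definition above :: "rat \<Rightarrow> real_frame" where "above p = real_frame_gen (Gen_above p)"
definition below :: "rat \<Rightarrow> real_frame" where "below p = real_frame_gen (Gen_below p)"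

definition satisfies_real_rels :: "(rat \<Rightarrow> 'l::frame) \<Rightarrow> (rat \<Rightarrow> 'l) \<Rightarrow> bool" where
  "satisfies_real_rels u v \<longleftrightarrow>
     (\<forall>p q. p \<ge> q \<longrightarrow> inf (u p) (v q) = bot) \<and>
     (\<forall>p q. p < q \<longrightarrow> sup (u p) (v q) = top) \<and>
     (\<forall>p. u p = (SUP q\<in>{q. q > p}. u q)) \<and>
     (\<forall>p. v p = (SUP q\<in>{q. q < p}. v q)) \<and>
     (SUP p. u p) = top \<and>
     (SUP p. v p) = top"

lemma real_frame_meet_le:
  assumes "real_rel_ideal D" "F |\<union>| H \<in> D"
    and "\<And>x. x |\<in>| F \<Longrightarrow> G \<in> real_frame_set (real_frame_gen x)"
  shows "G |\<union>| H \<in> D"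
  using assms(2,3)
proof (induction F arbitrary: H)
  case empty
  then show ?case using real_rel_ideal_up[OF assms(1), of H G] by (simp add: funion_commute)
next
  case (insert x F)
  have ideal: "real_rel_ideal {K. \<forall>L\<in>{H'. \<exists>L. H' = L \<and> finsert x H' \<in> D}. K |\<union>| L \<in> D}"
    by (rule real_rel_ideal_imp[OF assms(1)])
  have "F |\<union>| (finsert x H) \<in> D" using insert.prems by simp
  then have "G |\<union>| finsert x H \<in> D" using insert by blast
  then have *: "finsert x (G |\<union>| H) \<in> D" by simp
  have "G \<in> real_frame_set (real_frame_gen x)" using insert.prems by simp
  then have "G \<in> {K. \<forall>L\<in>{H'. \<exists>L. H' = L \<and> finsert x H' \<in> D}. K |\<union>| L \<in> D}"
    unfolding real_frame_gen.rep_eq using ideal by (auto simp: Inter_iff)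
  then have "G |\<union>| (G |\<union>| H) \<in> D" using * by blast
  then show ?case by (simp add: funion_assoc[symmetric])
qed

lemma Inf_gen_le:
  "F \<in> real_frame_set D \<Longrightarrow> Inf (real_frame_gen ` fset F) \<le> D"
proof -
  assume F: "F \<in> real_frame_set D"
  have D: "real_rel_ideal (real_frame_set D)" using real_frame_set by auto
  have "G \<in> real_frame_set D" if "G \<in> real_frame_set (Inf (real_frame_gen ` fset F))" for G
  proof -
    have "\<And>x. x |\<in>| F \<Longrightarrow> G \<in> real_frame_set (real_frame_gen x)"
      using that by (simp add: Inf_real_frame.rep_eq)
    then show ?thesis using real_frame_meet_le[OF D, of F "{||}" G] F by simp
  qed
  then show ?thesis by (auto simp: less_eq_real_frame.rep_eq)
qed

lemma mem_gen: "x |\<in>| F \<Longrightarrow> F \<in> real_frame_set (real_frame_gen x)"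
proof -
  assume "x |\<in>| F"
  then have "{|x|} |\<union>| F = F" by auto
  then show ?thesis unfolding real_frame_gen.rep_eq by (metis (mono_tags, lifting) InterI mem_Collect_eq real_rel_ideal_up)
qed

lemma mem_Inf_gen: "F \<in> real_frame_set (Inf (real_frame_gen ` fset F))"
  by (simp add: Inf_real_frame.rep_eq mem_gen)

lemma gen_le_iff: "real_frame_gen x \<le> D \<longleftrightarrow> {|x|} \<in> real_frame_set D"
  using Inf_gen_le[of "{|x|}" D] mem_gen[of x "{|x|}"] by (auto simp: less_eq_real_frame.rep_eq)

lemma real_frame_eq_SUP: "D = (SUP F\<in>real_frame_set D. Inf (real_frame_gen ` fset F))"
proof (rule antisym)
  let ?S = "SUP F\<in>real_frame_set D. Inf (real_frame_gen ` fset F)"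
  have "F \<in> real_frame_set ?S" if "F \<in> real_frame_set D" for F
    using SUP_upper[OF that, of "\<lambda>F. Inf (real_frame_gen ` fset F)"] mem_Inf_gen[of F]
    by (auto simp: less_eq_real_frame.rep_eq)
  then show "D \<le> ?S" by (auto simp: less_eq_real_frame.rep_eq)
qed (intro SUP_least Inf_gen_le)

lemma real_rel_sound:
  assumes "real_rel F \<G>"
  shows "Inf (real_frame_gen ` fset F) \<le> (SUP G\<in>\<G>. Inf (real_frame_gen ` fset G))"
proof -
  let ?S = "SUP G\<in>\<G>. Inf (real_frame_gen ` fset G)"
  have S: "real_rel_ideal (real_frame_set ?S)" using real_frame_set by auto
  have "G \<in> real_frame_set ?S" if "G \<in> \<G>" for G
    using SUP_upper[OF that, of "\<lambda>F. Inf (real_frame_gen ` fset F)"] mem_Inf_gen[of G]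
    by (auto simp: less_eq_real_frame.rep_eq)
  then have "F |\<union>| {||} \<in> real_frame_set ?S" by (intro real_rel_ideal_cover[OF S assms]) auto
  then show ?thesis by (intro Inf_gen_le) simp
qed

lemma satisfies_real_rels_above_below: "satisfies_real_rels above below"
  unfolding satisfies_real_rels_def
proof (intro conjI allI impI)
  show "inf (above p) (below q) = bot" if "p \<ge> q" for p q
    using real_rel_sound[OF real_rel.intros(1)[OF that]] by (simp add: above_def below_def le_bot)
  show "sup (above p) (below q) = top" if "p < q" for p q
    using real_rel_sound[OF real_rel.intros(2)[OF that]] by (simp add: above_def below_def top_le)
  show "above p = (SUP q\<in>{q. q > p}. above q)" for p
    using real_rel_sound[OF real_rel.intros(3)[of p]] real_rel_sound[OF real_rel.intros(4)[of p]]
    by (intro antisym SUP_least) (auto simp: above_def image_image)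
  show "below p = (SUP q\<in>{q. q < p}. below q)" for p
    using real_rel_sound[OF real_rel.intros(5)[of p]] real_rel_sound[OF real_rel.intros(6)[of _ p]]
    by (intro antisym SUP_least) (auto simp: below_def image_image)
  show "(SUP p. above p) = top"
    using real_rel_sound[OF real_rel.intros(7)] by (simp add: above_def image_image top_le)
  show "(SUP p. below p) = top"
    using real_rel_sound[OF real_rel.intros(8)] by (simp add: below_def image_image top_le)
qed

lemma frame_hom_top: "frame_hom h \<Longrightarrow> h top = top"
  and frame_hom_inf: "frame_hom h \<Longrightarrow> h (inf a b) = inf (h a) (h b)"
  and frame_hom_Sup: "frame_hom h \<Longrightarrow> h (Sup A) = Sup (h ` A)"
  by (auto simp: frame_hom_def)

lemma frame_hom_bot: "frame_hom h \<Longrightarrow> h bot = bot"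
  using frame_hom_Sup[of h "{}"] by simp

lemma frame_hom_sup: "frame_hom h \<Longrightarrow> h (sup a b) = sup (h a) (h b)"
  using frame_hom_Sup[of h "{a, b}"] by simp

lemma frame_hom_SUP: "frame_hom h \<Longrightarrow> h (SUP i\<in>I. f i) = (SUP i\<in>I. h (f i))"
  by (simp add: frame_hom_Sup image_image)

lemma frame_hom_Inf_fset: "frame_hom h \<Longrightarrow> h (Inf (f ` fset F)) = Inf ((\<lambda>x. h (f x)) ` fset F)"
  by (induction F) (auto simp: frame_hom_top frame_hom_inf)

lemma satisfies_real_relsD:
  assumes "satisfies_real_rels u v"
  shows "p \<ge> q \<Longrightarrow> inf (u p) (v q) = bot"
    and "p < q \<Longrightarrow> sup (u p) (v q) = top"
    and "u p = (SUP q\<in>{q. q > p}. u q)"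
    and "v p = (SUP q\<in>{q. q < p}. v q)"
    and "(SUP p. u p) = top"
    and "(SUP p. v p) = top"
    and "p \<le> q \<Longrightarrow> u q \<le> u p"
    and "p \<le> q \<Longrightarrow> v p \<le> v q"
proof -
  show uv: "p \<ge> q \<Longrightarrow> inf (u p) (v q) = bot" "p < q \<Longrightarrow> sup (u p) (v q) = top"
    "u p = (SUP q\<in>{q. q > p}. u q)" "v p = (SUP q\<in>{q. q < p}. v q)"
    "(SUP p. u p) = top" "(SUP p. v p) = top" for p q
    using assms unfolding satisfies_real_rels_def by blast+
  have "p < q \<Longrightarrow> u q \<le> u p" by (subst uv(3)[of p]) (rule SUP_upper, simp)
  then show "p \<le> q \<Longrightarrow> u q \<le> u p" by (cases "p = q") auto
  have "p < q \<Longrightarrow> v p \<le> v q" by (subst uv(4)[of q]) (rule SUP_upper, simp)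
  then show "p \<le> q \<Longrightarrow> v p \<le> v q" by (cases "p = q") auto
qed

lemma satisfies_real_rels_image:
  assumes h: "frame_hom h" and uv: "satisfies_real_rels u v"
  shows "satisfies_real_rels (\<lambda>p. h (u p)) (\<lambda>p. h (v p))"
  unfolding satisfies_real_rels_def
proof (intro conjI allI impI)
  show "inf (h (u p)) (h (v q)) = bot" if "p \<ge> q" for p q
    using satisfies_real_relsD(1)[OF uv that] by (metis frame_hom_bot[OF h] frame_hom_inf[OF h])
  show "sup (h (u p)) (h (v q)) = top" if "p < q" for p q
    using satisfies_real_relsD(2)[OF uv that] by (metis frame_hom_top[OF h] frame_hom_sup[OF h])
  show "h (u p) = (SUP q\<in>{q. q > p}. h (u q))" for p
    by (subst satisfies_real_relsD(3)[OF uv]) (rule frame_hom_SUP[OF h])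
  show "h (v p) = (SUP q\<in>{q. q < p}. h (v q))" for p
    by (subst satisfies_real_relsD(4)[OF uv]) (rule frame_hom_SUP[OF h])
  show "(SUP p. h (u p)) = top" "(SUP p. h (v p)) = top"
    using frame_hom_SUP[OF h, of u UNIV] frame_hom_SUP[OF h, of v UNIV]
    by (simp_all only: satisfies_real_relsD(5,6)[OF uv] frame_hom_top[OF h])
qed

lemma real_frame_universal_unique:
  assumes "frame_hom g" "frame_hom h"
    and "\<And>p. g (above p) = h (above p)" "\<And>p. g (below p) = h (below p)"
  shows "g = h"
proof
  fix D
  have "g (real_frame_gen x) = h (real_frame_gen x)" for x
    using assms(3,4) by (cases x) (auto simp: above_def below_def)
  then show "g D = h D"
    by (subst (1 2) real_frame_eq_SUP) (simp add: frame_hom_SUP frame_hom_Inf_fset assms)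
qed

lemma real_frame_universal_exists:
  assumes uv: "satisfies_real_rels u v"
  shows "\<exists>h. frame_hom h \<and> (\<forall>p. h (above p) = u p) \<and> (\<forall>p. h (below p) = v p)"
proof -
  define \<phi> where "\<phi> x = (case x of Gen_above p \<Rightarrow> u p | Gen_below p \<Rightarrow> v p)" for x
  define m where "m F = Inf (\<phi> ` fset F)" for F
  define h where "h D = (SUP F\<in>real_frame_set D. m F)" for D
  have m_union: "m (F |\<union>| G) = inf (m F) (m G)" for F G
    by (simp add: m_def Inf_union_distrib image_Un)
  have cover: "m F \<le> (SUP G\<in>\<G>. m G)" if "real_rel F \<G>" for F \<G>
    using that
  proof cases
    case (3 p)
    then show ?thesis
      using satisfies_real_relsD(3)[OF uv, of p] by (simp add: m_def \<phi>_def image_image)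
  next
    case (5 p)
    then show ?thesis
      using satisfies_real_relsD(4)[OF uv, of p] by (simp add: m_def \<phi>_def image_image)
  qed (use satisfies_real_relsD(1,2,5-8)[OF uv] in \<open>auto simp: m_def \<phi>_def image_image\<close>)
  have ideal: "real_rel_ideal {F. m F \<le> a}" for a
    unfolding real_rel_ideal_def
  proof (intro conjI ballI allI impI CollectI)
    show "m (F |\<union>| G) \<le> a" if "F \<in> {F. m F \<le> a}" for F G
      using that by (simp add: m_union le_infI1)
    fix F \<G> H assume *: "real_rel F \<G> \<and> (\<forall>G\<in>\<G>. G |\<union>| H \<in> {F. m F \<le> a})"
    then have "m (F |\<union>| H) \<le> inf (SUP G\<in>\<G>. m G) (m H)"
      using cover by (simp add: m_union le_infI1)
    also have "\<dots> \<le> a" using * by (auto simp: SUP_inf m_union intro: SUP_least)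
    finally show "m (F |\<union>| H) \<le> a" .
  qed
  define r where "r a = Abs_real_frame {F. m F \<le> a}" for a
  have rs: "real_frame_set (r a) = {F. m F \<le> a}" for a
    unfolding r_def using ideal[of a] by (intro Abs_real_frame_inverse) simp
  have r: "h D \<le> a \<longleftrightarrow> D \<le> r a" for D a
  proof -
    have "h D \<le> a \<longleftrightarrow> (\<forall>F\<in>real_frame_set D. m F \<le> a)"
      unfolding h_def by (rule SUP_le_iff)
    also have "\<dots> \<longleftrightarrow> real_frame_set D \<subseteq> real_frame_set (r a)"
      unfolding rs by (rule subset_eq[where B = "{F. m F \<le> a}" and A = "real_frame_set D", unfolded mem_Collect_eq, symmetric])
    finally show ?thesis unfolding less_eq_real_frame.rep_eq .
  qed
  have "frame_hom h"
    unfolding frame_hom_def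
  proof (intro conjI allI)
    have "m {||} \<le> h top" unfolding h_def
      by (rule SUP_upper) (simp only: top_real_frame_def Inf_real_frame.rep_eq, simp)
    then show "h top = top" by (simp add: m_def top_le)
    show "h (inf D E) = inf (h D) (h E)" for D E
    proof (rule antisym)
      show "h (inf D E) \<le> inf (h D) (h E)"
        by (auto simp: h_def inf_real_frame.rep_eq intro!: SUP_subset_mono)
      have "m F \<le> h D" if "F \<in> real_frame_set D" for F D
        using that by (auto simp: h_def intro: SUP_upper)
      moreover have "F |\<union>| G \<in> real_frame_set (inf D E)"
        if "F \<in> real_frame_set D" "G \<in> real_frame_set E" for F G
        using that real_frame_set real_rel_ideal_up[of _ F G] real_rel_ideal_up[of _ G F]
        by (auto simp: inf_real_frame.rep_eq funion_commute)
      ultimately have "inf (m F) (m G) \<le> h (inf D E)"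
        if "F \<in> real_frame_set D" "G \<in> real_frame_set E" for F G
        using that m_union by metis
      then show "inf (h D) (h E) \<le> h (inf D E)"
        unfolding h_def[of D] h_def[of E] by (simp add: SUP_inf inf_SUP SUP_le_iff)
    qed
    show "h (Sup A) = Sup (h ` A)" for A
    proof (rule antisym)
      show "h (Sup A) \<le> Sup (h ` A)"
        unfolding r by (intro Sup_least) (simp add: r[symmetric] SUP_upper)
      have "h D \<le> h (Sup A)" if "D \<in> A" for D
        unfolding r using that r[of "Sup A"] by (meson Sup_upper order_trans order_refl)
      then show "Sup (h ` A) \<le> h (Sup A)" by (intro SUP_least)
    qed
  qed
  moreover have "h (real_frame_gen x) = \<phi> x" for x
  proof (rule antisym)
    show "h (real_frame_gen x) \<le> \<phi> x"
      unfolding r by (simp add: gen_le_iff rs m_def)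
    have "m {|x|} \<le> h (real_frame_gen x)" unfolding h_def by (rule SUP_upper) (simp add: mem_gen)
    then show "\<phi> x \<le> h (real_frame_gen x)" by (simp add: m_def)
  qed
  ultimately show ?thesis unfolding above_def below_def \<phi>_def
    by (metis real_gen.case)
qed

lemma real_frame_universal:
  assumes "satisfies_real_rels u v"
  shows "\<exists>!h. frame_hom h \<and> (\<forall>p. h (above p) = u p) \<and> (\<forall>p. h (below p) = v p)"
  using real_frame_universal_exists[OF assms] real_frame_universal_unique by metis


section \<open>The Riesz space of continuous real functions on a frame\<close>

lemma satisfies_real_rels_zero:
  "satisfies_real_rels (\<lambda>p. if p < 0 then top else bot :: 'l::frame) (\<lambda>q. if q > 0 then top else bot)"
  unfolding satisfies_real_rels_def
proof (intro conjI allI impI)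
  show "(if p < 0 then top else bot :: 'l) = (SUP q\<in>{q. q > p}. if q < 0 then top else bot)" for p :: rat
  proof (cases "p < 0")
    case True
    then obtain q where "p < q" "q < 0" using dense by blast
    then have t: "top \<le> (SUP q\<in>{q. q > p}. if q < 0 then top else bot :: 'l)"
      by (intro SUP_upper2[of q]) auto
    show ?thesis unfolding top_le[OF t] using True by simp
  qed (auto intro!: antisym SUP_least)
  show "(if p > 0 then top else bot :: 'l) = (SUP q\<in>{q. q < p}. if q > 0 then top else bot)" for p :: rat
  proof (cases "p > 0")
    case True
    then obtain q where "0 < q" "q < p" using dense by blast
    then have t: "top \<le> (SUP q\<in>{q. q < p}. if q > 0 then top else bot :: 'l)"
      by (intro SUP_upper2[of q]) auto
    show ?thesis unfolding top_le[OF t] using True by simp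
  qed (auto intro!: antisym SUP_least)
  have "top \<le> (SUP p::rat. if p < 0 then top else bot :: 'l)" by (rule SUP_upper2[of "-1"]) auto
  then show "(SUP p::rat. if p < 0 then top else bot :: 'l) = top" by (rule top_le)
  have "top \<le> (SUP p::rat. if p > 0 then top else bot :: 'l)" by (rule SUP_upper2[of "1"]) auto
  then show "(SUP p::rat. if p > 0 then top else bot :: 'l) = top" by (rule top_le)
qed auto

typedef (overloaded) 'l cont = "{h :: real_frame \<Rightarrow> 'l::frame. frame_hom h}"
  morphisms cont_hom Abs_cont
  using real_frame_universal_exists[OF satisfies_real_rels_zero] by auto

text \<open>\<open>up f p\<close> and \<open>dn f q\<close> are \<open>f(p,-)\<close> and \<open>f(-,q)\<close>.\<close>

definition up :: "'l::frame cont \<Rightarrow> rat \<Rightarrow> 'l" where "up f p = cont_hom f (above p)"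
definition dn :: "'l::frame cont \<Rightarrow> rat \<Rightarrow> 'l" where "dn f q = cont_hom f (below q)"

text \<open>
  The frame homomorphism with prescribed values on the generators; it exists exactly when these
  values satisfy the defining relations of the frame of reals. Each use below is justified by a
  lemma \<open>satisfies_real_rels_...\<close>.
\<close>

definition cont_of :: "(rat \<Rightarrow> 'l::frame) \<Rightarrow> (rat \<Rightarrow> 'l) \<Rightarrow> 'l cont" where
  "cont_of u v = (THE f. (\<forall>p. up f p = u p) \<and> (\<forall>q. dn f q = v q))"

lemma cont_satisfies: "satisfies_real_rels (up f) (dn f)"
  using satisfies_real_rels_image[OF _ satisfies_real_rels_above_below, of "cont_hom f"] cont_hom[of f]
  by (simp add: up_def[abs_def] dn_def[abs_def])

lemmas contD = satisfies_real_relsD[OF cont_satisfies]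

lemma cont_of:
  assumes "satisfies_real_rels u v"
  shows up_cont_of: "up (cont_of u v) p = u p" and dn_cont_of: "dn (cont_of u v) p = v p"
proof -
  obtain h where h: "frame_hom h" "\<And>p. h (above p) = u p" "\<And>p. h (below p) = v p"
    using real_frame_universal_exists[OF assms] by blast
  have "\<exists>!f. (\<forall>p. up f p = u p) \<and> (\<forall>q. dn f q = v q)"
  proof (rule ex1I[of _ "Abs_cont h"])
    show "(\<forall>p. up (Abs_cont h) p = u p) \<and> (\<forall>q. dn (Abs_cont h) q = v q)"
      using h by (simp add: up_def dn_def Abs_cont_inverse)
    show "f = Abs_cont h" if "(\<forall>p. up f p = u p) \<and> (\<forall>q. dn f q = v q)" for f
    proof -
      have "cont_hom f = h"
        using that h cont_hom[of f] by (intro real_frame_universal_unique) (auto simp: up_def dn_def)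
      then show ?thesis using cont_hom_inverse[of f] by simp
    qed
  qed
  from theI'[OF this] show "up (cont_of u v) p = u p" "dn (cont_of u v) p = v p"
    unfolding cont_of_def by blast+
qed

lemma dn_mono_if_up:
  assumes "\<And>p. up f p \<le> up g p"
  shows "dn g q \<le> dn f q"
proof -
  have "dn g p \<le> dn f q" if "p < q" for p
  proof -
    have "dn g p = inf (dn g p) (sup (up f p) (dn f q))" using contD(2)[OF that, of f] by simp
    also have "\<dots> = sup (inf (dn g p) (up f p)) (inf (dn g p) (dn f q))" by (rule inf_sup_distrib)
    also have "inf (dn g p) (up f p) \<le> inf (up g p) (dn g p)"
      using assms by (simp add: le_infI1 le_infI2)
    then have "inf (dn g p) (up f p) = bot" using contD(1)[of p p g] by (simp add: le_bot)
    finally show ?thesis by (metis inf.cobounded2 sup_bot_left)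
  qed
  then have "(SUP p\<in>{p. p < q}. dn g p) \<le> dn f q" by (intro SUP_least) auto
  then show ?thesis by (simp only: contD(4)[of g q, symmetric])
qed

lemma cont_eqI:
  assumes "\<And>p. up f p = up g p" shows "f = g"
proof -
  have "dn f p = dn g p" for p using dn_mono_if_up[of f g] dn_mono_if_up[of g f] assms by (simp add: antisym)
  then have "cont_hom f = cont_hom g"
    using assms cont_hom[of f] cont_hom[of g]
    by (intro real_frame_universal_unique) (auto simp: up_def dn_def)
  then show ?thesis by (simp add: cont_hom_inject)
qed

lemma cont_partition:
  assumes "e > 0"
  shows "(SUP r. inf (up f r) (dn f (r + e))) = top"
proof -
  let ?J = "SUP r. inf (up f r) (dn f (r + e))"
  have step: "inf (up f a) (dn f (a + of_nat n * (e/2))) \<le> ?J" for n a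
  proof (induction n arbitrary: a)
    case 0
    then show ?case using contD(1)[of a a f] by simp
  next
    case (Suc n)
    let ?x = "inf (up f a) (dn f (a + of_nat (Suc n) * (e/2)))"
    have "sup (up f (a + e/2)) (dn f (a + e)) = top" using assms by (intro contD(2)) simp
    then have eq: "?x = sup (inf ?x (up f (a + e/2))) (inf ?x (dn f (a + e)))"
      by (metis inf_sup_distrib inf_top.right_neutral)
    have "inf ?x (up f (a + e/2)) \<le> ?J"
    proof (rule order_trans[OF _ Suc.IH[of "a + e/2"]])
      have "a + of_nat (Suc n) * (e/2) = a + e/2 + of_nat n * (e/2)" by (simp add: field_simps)
      then show "inf ?x (up f (a + e/2)) \<le> inf (up f (a + e/2)) (dn f (a + e/2 + of_nat n * (e/2)))"
        by (metis inf.cobounded2 inf.coboundedI1 inf_greatest)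
    qed
    moreover have "inf ?x (dn f (a + e)) \<le> ?J"
      by (rule SUP_upper2[of a]) (auto simp: le_infI1)
    ultimately show ?case by (subst eq) (rule sup_least)
  qed
  have "inf (up f a) (dn f b) \<le> ?J" for a b
  proof -
    obtain n where "(b - a) / (e/2) \<le> of_nat n" using real_arch_simple by blast
    then have "b \<le> a + of_nat n * (e/2)" using assms by (simp add: field_simps)
    then have "dn f b \<le> dn f (a + of_nat n * (e/2))" by (rule contD(8))
    then show ?thesis using step[of a n] by (meson inf_mono order_refl order_trans)
  qed
  then have "inf (SUP a. up f a) (SUP b. dn f b) \<le> ?J"
    by (simp add: SUP_inf inf_SUP SUP_le_iff)
  then show ?thesis by (simp add: contD(5,6) top_le)
qed

lemma SUP_uminus: "(SUP q\<in>{q. P q}. f (- q :: rat)) = (SUP q\<in>{q. P (- q)}. f q :: 'l::complete_lattice)"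
proof (rule SUP_eq)
  show "\<exists>j\<in>{q. P (- q)}. f (- i) \<le> f j" if "i \<in> {q. P q}" for i
    using that by (intro bexI[of _ "- i"]) auto
  show "\<exists>i\<in>{q. P q}. f j \<le> f (- i)" if "j \<in> {q. P (- q)}" for j
    using that by (intro bexI[of _ "- j"]) auto
qed

lemma satisfies_real_rels_swap:
  assumes "satisfies_real_rels u v"
  shows "satisfies_real_rels (\<lambda>p. v (- p)) (\<lambda>q. u (- q))"
  unfolding satisfies_real_rels_def
proof (intro conjI allI impI)
  note D = satisfies_real_relsD[OF assms]
  show "inf (v (- p)) (u (- q)) = bot" if "p \<ge> q" for p q using D(1)[of "- p" "- q"] that by (simp add: inf.commute)
  show "sup (v (- p)) (u (- q)) = top" if "p < q" for p q using D(2)[of "- q" "- p"] that by (simp add: sup.commute)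
  show "v (- p) = (SUP q\<in>{q. q > p}. v (- q))" for p
    unfolding SUP_uminus[where P = "\<lambda>q. q > p" and f = v] less_minus_iff[of p] by (rule D(4))
  show "u (- p) = (SUP q\<in>{q. q < p}. u (- q))" for p
    unfolding SUP_uminus[where P = "\<lambda>q. q < p" and f = u] minus_less_iff[of _ p] by (rule D(3))
  show "(SUP p. v (- p)) = top" using SUP_uminus[where P = "\<lambda>_. True" and f = v] D(6) by simp
  show "(SUP p. u (- p)) = top" using SUP_uminus[where P = "\<lambda>_. True" and f = u] D(5) by simp
qed

lemma satisfies_real_rels_sup:
  assumes "satisfies_real_rels u v" "satisfies_real_rels u' v'"
  shows "satisfies_real_rels (\<lambda>p. sup (u p) (u' p)) (\<lambda>q. inf (v q) (v' q))"
  unfolding satisfies_real_rels_def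
proof (intro conjI allI impI)
  note D = satisfies_real_relsD[OF assms(1)] and D' = satisfies_real_relsD[OF assms(2)]
  show "inf (sup (u p) (u' p)) (inf (v q) (v' q)) = bot" if "p \<ge> q" for p q
  proof -
    have "inf (u p) (inf (v q) (v' q)) = bot" using D(1)[OF that] by (metis inf.assoc inf_bot_left)
    moreover have "inf (u' p) (inf (v q) (v' q)) = bot"
      using D'(1)[OF that] by (metis inf.left_commute inf_bot_right)
    ultimately show ?thesis by (simp add: inf_sup_distrib2)
  qed
  show "sup (sup (u p) (u' p)) (inf (v q) (v' q)) = top" if "p < q" for p q
  proof -
    have "sup (sup (u p) (u' p)) (v q) = top" using D(2)[OF that] by (metis sup.commute sup.left_commute sup_top_left)
    moreover have "sup (sup (u p) (u' p)) (v' q) = top"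
      using D'(2)[OF that] by (metis sup.assoc sup_top_right)
    ultimately show ?thesis by (simp add: sup_inf_distrib1)
  qed
  show "sup (u p) (u' p) = (SUP q\<in>{q. q > p}. sup (u q) (u' q))" for p
    using complete_lattice_class.SUP_sup_distrib[where f = u and g = u' and A = "{q. q > p}"]
    by (simp only: D(3)[of p, symmetric] D'(3)[of p, symmetric])
  show "inf (v p) (v' p) = (SUP q\<in>{q. q < p}. inf (v q) (v' q))" for p
  proof (rule antisym)
    have "inf (v s) (v' t) \<le> (SUP q\<in>{q. q < p}. inf (v q) (v' q))" if "s < p" "t < p" for s t
      using that by (intro SUP_upper2[of "max s t"] inf_mono D(8) D'(8)) auto
    then have "inf (SUP q\<in>{q. q < p}. v q) (SUP q\<in>{q. q < p}. v' q) \<le> (SUP q\<in>{q. q < p}. inf (v q) (v' q))"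
      unfolding SUP_inf inf_SUP by (intro SUP_least) auto
    then show "inf (v p) (v' p) \<le> (SUP q\<in>{q. q < p}. inf (v q) (v' q))"
      by (simp only: D(4)[of p, symmetric] D'(4)[of p, symmetric])
    show "(SUP q\<in>{q. q < p}. inf (v q) (v' q)) \<le> inf (v p) (v' p)"
      by (intro SUP_least inf_mono D(8) D'(8)) auto
  qed
  have "(SUP p. u p) \<le> (SUP p. sup (u p) (u' p))" by (intro SUP_mono') simp
  then show "(SUP p. sup (u p) (u' p)) = top" by (simp add: D(5) top_le)
  have "inf (v s) (v' t) \<le> (SUP q. inf (v q) (v' q))" for s t
    by (intro SUP_upper2[of "max s t"] inf_mono D(8) D'(8)) auto
  then have "inf (SUP q. v q) (SUP q. v' q) \<le> (SUP q. inf (v q) (v' q))"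
    unfolding SUP_inf inf_SUP by (intro SUP_least) auto
  then show "(SUP q. inf (v q) (v' q)) = top" by (simp add: D(6) D'(6) top_le)
qed

lemma satisfies_real_rels_inf:
  assumes "satisfies_real_rels u v" "satisfies_real_rels u' v'"
  shows "satisfies_real_rels (\<lambda>p. inf (u p) (u' p)) (\<lambda>q. sup (v q) (v' q))"
  using satisfies_real_rels_swap[OF satisfies_real_rels_sup[OF
        satisfies_real_rels_swap[OF assms(1)] satisfies_real_rels_swap[OF assms(2)]]]
  by simp

lemma cont_add_covers:
  fixes f g :: "'l::frame cont" and p :: rat
  shows "(SUP r. inf (up f r) (up g (p - r))) = (SUP p'\<in>{p'. p' > p}. SUP r. inf (up f r) (up g (p' - r)))"
    and "(SUP p. SUP r. inf (up f r) (up g (p - r))) = top"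
proof -
  show "(SUP r. inf (up f r) (up g (p - r))) = (SUP p'\<in>{p'. p' > p}. SUP r. inf (up f r) (up g (p' - r)))" (is "?L = ?R")
  proof (rule antisym)
    have "inf (up f r) (up g (p - r)) \<le> ?R" for r
    proof -
      have "inf (up f r) (up g t) \<le> ?R" if "t > p - r" for t
        using that by (intro SUP_upper2[of "t + r"] SUP_upper2[of r]) auto
      then have "inf (up f r) (SUP t\<in>{t. t > p - r}. up g t) \<le> ?R"
        unfolding inf_SUP by (intro SUP_least) auto
      then show ?thesis by (simp only: contD(3)[of g "p - r", symmetric])
    qed
    then show "?L \<le> ?R" by (rule SUP_least)
    have "inf (up f r) (up g (p' - r)) \<le> ?L" if "p' > p" for p' r
      using that by (intro SUP_upper2[of r] inf_mono contD(7)) auto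
    then show "?R \<le> ?L" by (intro SUP_least) auto
  qed
  have "inf (up f a) (up g b) \<le> (SUP p. SUP r. inf (up f r) (up g (p - r)))" for a b
    by (intro SUP_upper2[of "a + b"] SUP_upper2[of a]) auto
  then have "inf (SUP a. up f a) (SUP b. up g b) \<le> (SUP p. SUP r. inf (up f r) (up g (p - r)))"
    unfolding SUP_inf inf_SUP by (intro SUP_least) auto
  then show "(SUP p. SUP r. inf (up f r) (up g (p - r))) = top" by (simp add: contD(5) top_le)
qed

lemma cont_add_covers':
  fixes f g :: "'l::frame cont" and p :: rat
  shows "(SUP r. inf (dn f r) (dn g (p - r))) = (SUP p'\<in>{p'. p' < p}. SUP r. inf (dn f r) (dn g (p' - r)))"
    and "(SUP p. SUP r. inf (dn f r) (dn g (p - r))) = top"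
proof -
  show "(SUP r. inf (dn f r) (dn g (p - r))) = (SUP p'\<in>{p'. p' < p}. SUP r. inf (dn f r) (dn g (p' - r)))" (is "?L = ?R")
  proof (rule antisym)
    have "inf (dn f r) (dn g (p - r)) \<le> ?R" for r
    proof -
      have "inf (dn f r) (dn g t) \<le> ?R" if "t < p - r" for t
        using that by (intro SUP_upper2[of "t + r"] SUP_upper2[of r]) auto
      then have "inf (dn f r) (SUP t\<in>{t. t < p - r}. dn g t) \<le> ?R"
        unfolding inf_SUP by (intro SUP_least) auto
      then show ?thesis by (simp only: contD(4)[of g "p - r", symmetric])
    qed
    then show "?L \<le> ?R" by (rule SUP_least)
    have "inf (dn f r) (dn g (p' - r)) \<le> ?L" if "p' < p" for p' r
      using that by (intro SUP_upper2[of r] inf_mono contD(8)) auto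
    then show "?R \<le> ?L" by (intro SUP_least) auto
  qed
  have "inf (dn f a) (dn g b) \<le> (SUP p. SUP r. inf (dn f r) (dn g (p - r)))" for a b
    by (intro SUP_upper2[of "a + b"] SUP_upper2[of a]) auto
  then have "inf (SUP a. dn f a) (SUP b. dn g b) \<le> (SUP p. SUP r. inf (dn f r) (dn g (p - r)))"
    unfolding SUP_inf inf_SUP by (intro SUP_least) auto
  then show "(SUP p. SUP r. inf (dn f r) (dn g (p - r))) = top" by (simp add: contD(6) top_le)
qed

lemma satisfies_real_rels_add:
  fixes f g :: "'l::frame cont"
  shows "satisfies_real_rels (\<lambda>p. SUP r. inf (up f r) (up g (p - r))) (\<lambda>q. SUP s. inf (dn f s) (dn g (q - s)))"
  unfolding satisfies_real_rels_def
proof (intro conjI allI impI cont_add_covers cont_add_covers')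
  fix p q :: rat
  show "inf (SUP r. inf (up f r) (up g (p - r))) (SUP s. inf (dn f s) (dn g (q - s))) = bot" if "p \<ge> q"
  proof -
    have "inf (inf (up f r) (up g (p - r))) (inf (dn f s) (dn g (q - s))) \<le> bot" for r s
    proof (cases "s \<le> r")
      case True
      then have "inf (up f r) (dn f s) = bot" by (rule contD(1))
      then show ?thesis by (metis inf_le1 inf_le2 inf_mono)
    next
      case False
      with that have "inf (up g (p - r)) (dn g (q - s)) = bot" by (intro contD(1)) simp
      then show ?thesis by (metis inf_le1 inf_le2 inf_mono)
    qed
    then have "inf (SUP r. inf (up f r) (up g (p - r))) (SUP s. inf (dn f s) (dn g (q - s))) \<le> bot"
      unfolding SUP_inf inf_SUP by (intro SUP_least)
    then show ?thesis by (rule le_bot)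
  qed
  show "sup (SUP r. inf (up f r) (up g (p - r))) (SUP s. inf (dn f s) (dn g (q - s))) = top" (is "?S = top") if "p < q"
  proof -
    define e where "e = (q - p) / 2"
    have e: "e > 0" "p + e < q" using that by (auto simp: e_def field_simps)
    have "inf (up f r) (dn f (r + e)) \<le> ?S" for r
    proof -
      let ?x = "inf (up f r) (dn f (r + e))"
      have "sup (up g (p - r)) (dn g (q - (r + e))) = top" using e by (intro contD(2)) simp
      then have "?x = sup (inf ?x (up g (p - r))) (inf ?x (dn g (q - (r + e))))"
        by (metis inf_sup_distrib inf_top.right_neutral)
      also have "\<dots> \<le> ?S"
      proof (rule sup_mono)
        show "inf ?x (up g (p - r)) \<le> (SUP r. inf (up f r) (up g (p - r)))"
          by (intro SUP_upper2[of r] inf_mono) auto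
        show "inf ?x (dn g (q - (r + e))) \<le> (SUP s. inf (dn f s) (dn g (q - s)))"
          by (intro SUP_upper2[of "r + e"] inf_mono) auto
      qed
      finally show ?thesis .
    qed
    then have "(SUP r. inf (up f r) (dn f (r + e))) \<le> ?S" by (rule SUP_least)
    then show ?thesis using cont_partition[OF e(1), of f] by (simp add: top_le)
  qed
qed

lemma satisfies_real_rels_scale:
  fixes f :: "'l::frame cont" and c :: real
  assumes c: "c > 0"
  shows "satisfies_real_rels (\<lambda>p. SUP r\<in>{r. c * of_rat r > of_rat p}. up f r)
    (\<lambda>q. SUP s\<in>{s. c * of_rat s < of_rat q}. dn f s)"
  unfolding satisfies_real_rels_def
proof (intro conjI allI impI)
  fix p q :: rat
  show "inf (SUP r\<in>{r. c * of_rat r > of_rat p}. up f r) (SUP s\<in>{s. c * of_rat s < of_rat q}. dn f s) = bot"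
    if "p \<ge> q"
  proof -
    have "inf (up f r) (dn f s) \<le> bot" if r: "c * of_rat r > of_rat p" and s: "c * of_rat s < of_rat q" for r s
    proof -
      have "c * of_rat s < c * of_rat r"
        using r s \<open>p \<ge> q\<close> by (meson le_less_trans less_trans of_rat_less_eq less_le_trans)
      then have "s < r" using c by (simp add: of_rat_less)
      then show ?thesis using contD(1)[of s r f] by simp
    qed
    then show ?thesis unfolding SUP_inf inf_SUP by (intro le_bot SUP_least) auto
  qed
  show "sup (SUP r\<in>{r. c * of_rat r > of_rat p}. up f r) (SUP s\<in>{s. c * of_rat s < of_rat q}. dn f s) = top" (is "?S = top")
    if "p < q"
  proof -
    have "of_rat p / c < of_rat q / c" using that c by (simp add: divide_strict_right_mono of_rat_less)
    then obtain r where r: "of_rat p / c < of_rat r" "of_rat r < of_rat q / c" using of_rat_dense by blast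
    then obtain s where s: "of_rat r < (of_rat s :: real)" "of_rat s < of_rat q / c" using of_rat_dense by blast
    have "sup (up f r) (dn f s) = top" using s by (intro contD(2)) (simp add: of_rat_less)
    moreover have "sup (up f r) (dn f s) \<le> ?S"
      using r s c by (intro sup_mono SUP_upper) (auto simp: field_simps)
    ultimately show ?thesis by (simp add: top_le)
  qed
  show "(SUP r\<in>{r. c * of_rat r > of_rat p}. up f r) = (SUP p'\<in>{p'. p' > p}. SUP r\<in>{r. c * of_rat r > of_rat p'}. up f r)" (is "?L = ?R")
  proof (rule antisym)
    have "up f r \<le> ?R" if r: "c * of_rat r > of_rat p" for r
    proof -
      obtain p' where "of_rat p < (of_rat p' :: real)" "of_rat p' < c * of_rat r"
        using of_rat_dense[OF r] by blast
      then show ?thesis by (intro SUP_upper2[of p'] SUP_upper2[of r]) (auto simp: of_rat_less)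
    qed
    then show "?L \<le> ?R" by (intro SUP_least) auto
    show "?R \<le> ?L"
      by (intro SUP_least SUP_upper) (auto, meson less_trans of_rat_less)
  qed
  show "(SUP r\<in>{r. c * of_rat r < of_rat p}. dn f r) = (SUP p'\<in>{p'. p' < p}. SUP r\<in>{r. c * of_rat r < of_rat p'}. dn f r)" (is "?L = ?R")
  proof (rule antisym)
    have "dn f r \<le> ?R" if r: "c * of_rat r < of_rat p" for r
    proof -
      obtain p' where "c * of_rat r < of_rat p'" "of_rat p' < (of_rat p :: real)"
        using of_rat_dense[OF r] by blast
      then show ?thesis by (intro SUP_upper2[of p'] SUP_upper2[of r]) (auto simp: of_rat_less)
    qed
    then show "?L \<le> ?R" by (intro SUP_least) auto
    show "?R \<le> ?L"
      by (intro SUP_least SUP_upper) (auto, meson less_trans of_rat_less)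
  qed
  have "up f r \<le> (SUP p. SUP r\<in>{r. c * of_rat r > of_rat p}. up f r)" for r
  proof -
    obtain p where "c * of_rat r - 1 < of_rat p" "of_rat p < c * of_rat r"
      using of_rat_dense[of "c * of_rat r - 1" "c * of_rat r"] by auto
    then show ?thesis by (intro SUP_upper2[of p] SUP_upper2[of r]) auto
  qed
  then have "(SUP r. up f r) \<le> (SUP p. SUP r\<in>{r. c * of_rat r > of_rat p}. up f r)" by (rule SUP_least)
  then show "(SUP p. SUP r\<in>{r. c * of_rat r > of_rat p}. up f r) = top" by (simp add: contD(5) top_le)
  have "dn f r \<le> (SUP p. SUP r\<in>{r. c * of_rat r < of_rat p}. dn f r)" for r
  proof -
    obtain p where "c * of_rat r < of_rat p" "of_rat p < c * of_rat r + 1"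
      using of_rat_dense[of "c * of_rat r" "c * of_rat r + 1"] by auto
    then show ?thesis by (intro SUP_upper2[of p] SUP_upper2[of r]) auto
  qed
  then have "(SUP r. dn f r) \<le> (SUP p. SUP r\<in>{r. c * of_rat r < of_rat p}. dn f r)" by (rule SUP_least)
  then show "(SUP p. SUP r\<in>{r. c * of_rat r < of_rat p}. dn f r) = top" by (simp add: contD(6) top_le)
qed

text \<open>
  The values on \<open>(-,q)\<close> in the definitions of \<open>sup\<close> and \<open>inf\<close> are forced by those on \<open>(p,-)\<close>;
  see \<open>cont_eqI\<close>.
\<close>

instantiation cont :: (frame) lattice
begin

definition less_eq_cont :: "'a cont \<Rightarrow> 'a cont \<Rightarrow> bool" where
  "f \<le> g \<longleftrightarrow> (\<forall>p. up f p \<le> up g p)"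
definition less_cont :: "'a cont \<Rightarrow> 'a cont \<Rightarrow> bool" where
  "f < g \<longleftrightarrow> f \<le> g \<and> \<not> g \<le> (f :: 'a cont)"
definition sup_cont :: "'a cont \<Rightarrow> 'a cont \<Rightarrow> 'a cont" where
  "sup f g = cont_of (\<lambda>p. sup (up f p) (up g p)) (\<lambda>q. inf (dn f q) (dn g q))"
definition inf_cont :: "'a cont \<Rightarrow> 'a cont \<Rightarrow> 'a cont" where
  "inf f g = cont_of (\<lambda>p. inf (up f p) (up g p)) (\<lambda>q. sup (dn f q) (dn g q))"

lemma up_sup: "up (sup f g) p = sup (up f p) (up g p)"
  and up_inf: "up (inf f g) p = inf (up f p) (up g p)"
  unfolding sup_cont_def inf_cont_def
  by (rule up_cont_of[OF satisfies_real_rels_sup[OF cont_satisfies cont_satisfies]]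
      up_cont_of[OF satisfies_real_rels_inf[OF cont_satisfies cont_satisfies]])+

instance
proof
  show "f \<le> g \<Longrightarrow> g \<le> f \<Longrightarrow> f = g" for f g :: "'a cont"
    unfolding less_eq_cont_def by (intro cont_eqI antisym) auto
qed (auto simp: less_eq_cont_def less_cont_def up_sup up_inf intro: order_trans)

end

text \<open>
  \<open>pos_scale c\<close> is meaningful for \<open>c > 0\<close> only; multiplication by other scalars is then forced by
  the vector space axioms.
\<close>

instantiation cont :: (frame) "{zero, plus, uminus, minus, scaleR, abs}"
begin

definition zero_cont :: "'a cont" where
  "0 = cont_of (\<lambda>p. if p < 0 then top else bot) (\<lambda>q. if q > 0 then top else bot)"
definition plus_cont :: "'a cont \<Rightarrow> 'a cont \<Rightarrow> 'a cont" where
  "f + g = cont_of (\<lambda>p. SUP r. inf (up f r) (up g (p - r))) (\<lambda>q. SUP s. inf (dn f s) (dn g (q - s)))"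
definition uminus_cont :: "'a cont \<Rightarrow> 'a cont" where
  "- f = cont_of (\<lambda>p. dn f (- p)) (\<lambda>q. up f (- q))"
definition minus_cont :: "'a cont \<Rightarrow> 'a cont \<Rightarrow> 'a cont" where
  "f - g = f + (- g :: 'a cont)"
definition pos_scale :: "real \<Rightarrow> 'a cont \<Rightarrow> 'a cont" where
  "pos_scale c f = cont_of (\<lambda>p. SUP r\<in>{r. c * of_rat r > of_rat p}. up f r)
     (\<lambda>q. SUP s\<in>{s. c * of_rat s < of_rat q}. dn f s)"
definition scaleR_cont :: "real \<Rightarrow> 'a cont \<Rightarrow> 'a cont" where
  "c *\<^sub>R f = (if c > 0 then pos_scale c f else if c = 0 then 0 else - pos_scale (- c) f)"
definition abs_cont :: "'a cont \<Rightarrow> 'a cont" where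
  "\<bar>f\<bar> = sup f (- f :: 'a cont)"

instance ..

end

lemma up_zero: "up 0 p = (if p < 0 then top else bot)"
  and dn_zero: "dn 0 q = (if q > 0 then top else bot)"
  unfolding zero_cont_def by (rule cont_of[OF satisfies_real_rels_zero])+

lemma up_add: "up (f + g) p = (SUP r. inf (up f r) (up g (p - r)))"
  and dn_add: "dn (f + g) q = (SUP s. inf (dn f s) (dn g (q - s)))"
  unfolding plus_cont_def by (rule cont_of[OF satisfies_real_rels_add])+

lemma up_uminus: "up (- f) p = dn f (- p)"
  and dn_uminus: "dn (- f) q = up f (- q)"
  unfolding uminus_cont_def by (rule cont_of[OF satisfies_real_rels_swap[OF cont_satisfies]])+

lemma
  assumes "c > 0"
  shows up_pos_scale: "up (pos_scale c f) p = (SUP r\<in>{r. c * of_rat r > of_rat p}. up f r)"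
    and dn_pos_scale: "dn (pos_scale c f) q = (SUP s\<in>{s. c * of_rat s < of_rat q}. dn f s)"
  unfolding pos_scale_def by (rule cont_of[OF satisfies_real_rels_scale[OF assms]])+

lemma up_pos_scale_leI:
  assumes "c > 0" "\<And>r. c * of_rat r > of_rat p \<Longrightarrow> up f r \<le> x"
  shows "up (pos_scale c f) p \<le> x"
  unfolding up_pos_scale[OF assms(1)] by (intro SUP_least assms(2)) simp

lemma le_up_pos_scaleI:
  assumes "c > 0" "c * of_rat r > of_rat p" "x \<le> up f r"
  shows "x \<le> up (pos_scale c f) p"
  unfolding up_pos_scale[OF assms(1)] by (rule SUP_upper2[of r]) (use assms in auto)

lemma up_add_leI:
  assumes "\<And>r s. r + s = p \<Longrightarrow> inf (up f r) (up g s) \<le> x"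
  shows "up (f + g) p \<le> x"
  unfolding up_add by (intro SUP_least assms) simp

lemma le_up_addI:
  assumes "r + s = p" "x \<le> up f r" "x \<le> up g s"
  shows "x \<le> up (f + g) p"
  unfolding up_add by (rule SUP_upper2[of r]) (use assms in auto)

lemma cont_add_commute: "f + g = g + (f :: 'l::frame cont)"
proof -
  have "up (f + g) p \<le> up (g + f) p" for f g :: "'l cont" and p
  proof (rule up_add_leI)
    show "inf (up f r) (up g s) \<le> up (g + f) p" if "r + s = p" for r s
      by (rule le_up_addI[of s r]) (use that in \<open>auto simp: add.commute\<close>)
  qed
  then show ?thesis by (intro cont_eqI antisym)
qed

lemma cont_add_assoc: "(f + g) + h = f + (g + (h :: 'l::frame cont))"
proof -
  have le: "up ((f + g) + h) p \<le> up (f + (g + h)) p" for f g h :: "'l cont" and p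
  proof (rule up_add_leI)
    fix r s assume rs: "r + s = p"
    have "inf (inf (up f a) (up g (r - a))) (up h s) \<le> up (f + (g + h)) p" for a
      by (rule le_up_addI[of a "r - a + s"], use rs in simp, simp add: le_infI1)
        (rule le_up_addI[of "r - a" s], auto simp: le_infI1)
    then show "inf (up (f + g) r) (up h s) \<le> up (f + (g + h)) p"
      unfolding up_add[of f g r] SUP_inf by (intro SUP_least)
  qed
  have "up (f + (g + h)) p \<le> up ((f + g) + h) p" for p
    using le[of h g f p] by (simp add: cont_add_commute)
  with le show ?thesis by (intro cont_eqI antisym)
qed

lemma cont_add_zero: "0 + f = (f :: 'l::frame cont)"
proof (intro cont_eqI antisym)
  fix p
  show "up (0 + f) p \<le> up f p"
    by (rule up_add_leI) (auto simp: up_zero intro: contD(7))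
  have "up f q \<le> up (0 + f) p" if "q > p" for q
    using that by (intro le_up_addI[of "p - q" q]) (auto simp: up_zero)
  then have "(SUP q\<in>{q. q > p}. up f q) \<le> up (0 + f) p" by (intro SUP_least) auto
  then show "up f p \<le> up (0 + f) p" by (simp only: contD(3)[of f p, symmetric])
qed

lemma cont_add_uminus: "- f + f = (0 :: 'l::frame cont)"
proof (intro cont_eqI antisym)
  fix p
  show "up (- f + f) p \<le> up 0 p"
  proof (cases "p < 0")
    case False
    have "inf (up (- f) r) (up f s) = bot" if "r + s = p" for r s
      using contD(1)[of "- r" s f] that False by (simp add: up_uminus inf.commute)
    then show ?thesis by (intro up_add_leI) auto
  qed (simp add: up_zero)
  show "up 0 p \<le> up (- f + f) p"
  proof (cases "p < 0")
    case True
    have "inf (up f r) (dn f (r + - p)) \<le> up (- f + f) p" for r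
      by (rule le_up_addI[of "p - r" r]) (auto simp: up_uminus)
    then have "(SUP r. inf (up f r) (dn f (r + - p))) \<le> up (- f + f) p" by (rule SUP_least)
    then show ?thesis using cont_partition[of "- p" f] True by (simp add: up_zero)
  qed (simp add: up_zero)
qed

instance cont :: (frame) ordered_ab_group_add
proof
  fix a b c :: "'a cont"
  show "a + b + c = a + (b + c)" by (rule cont_add_assoc)
  show "a + b = b + a" by (rule cont_add_commute)
  show "0 + a = a" by (rule cont_add_zero)
  show "- a + a = 0" by (rule cont_add_uminus)
  show "a - b = a + - b" by (rule minus_cont_def)
  assume ab: "a \<le> b"
  have "inf (up c r) (up a s) \<le> up (c + b) p" if "r + s = p" for r s p
    by (rule le_up_addI[OF that]) (use ab in \<open>auto simp: less_eq_cont_def intro: le_infI2\<close>)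
  then show "c + a \<le> c + b"
    unfolding less_eq_cont_def by (intro allI up_add_leI)
qed

lemma pos_scale_add:
  assumes c: "c > 0"
  shows "pos_scale c (f + g) = pos_scale c f + pos_scale c (g :: 'l::frame cont)"
proof (intro cont_eqI antisym)
  fix p
  show "up (pos_scale c (f + g)) p \<le> up (pos_scale c f + pos_scale c g) p"
  proof (intro up_pos_scale_leI[OF c] up_add_leI)
    fix r a b assume "of_rat p < c * of_rat r" "a + b = r"
    then have "of_rat p - c * of_rat b < c * of_rat a" by (auto simp: of_rat_add algebra_simps)
    then obtain t where t: "of_rat p - c * of_rat b < of_rat t" "of_rat t < c * of_rat a"
      using of_rat_dense by blast
    show "inf (up f a) (up g b) \<le> up (pos_scale c f + pos_scale c g) p"
    proof (rule le_up_addI[of t "p - t"])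
      show "inf (up f a) (up g b) \<le> up (pos_scale c f) t"
        using t by (intro le_up_pos_scaleI[OF c, of _ a]) auto
      show "inf (up f a) (up g b) \<le> up (pos_scale c g) (p - t)"
        using t by (intro le_up_pos_scaleI[OF c, of _ b]) (auto simp: of_rat_diff)
    qed simp
  qed
  show "up (pos_scale c f + pos_scale c g) p \<le> up (pos_scale c (f + g)) p"
  proof (rule up_add_leI)
    fix r s assume rs: "r + s = p"
    have "inf (up f a) (up g b) \<le> up (pos_scale c (f + g)) p"
      if "c * of_rat a > of_rat r" "c * of_rat b > of_rat s" for a b
      using that rs
      by (intro le_up_pos_scaleI[OF c, of _ "a + b"] le_up_addI[of a b]) (auto simp: of_rat_add algebra_simps)
    then show "inf (up (pos_scale c f) r) (up (pos_scale c g) s) \<le> up (pos_scale c (f + g)) p"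
      unfolding up_pos_scale[OF c, of f] up_pos_scale[OF c, of g] SUP_inf inf_SUP
      by (intro SUP_least) auto
  qed
qed

lemma pos_scale_add_left:
  assumes c: "c > 0" and d: "d > 0"
  shows "pos_scale (c + d) f = pos_scale c f + pos_scale d (f :: 'l::frame cont)"
proof (intro cont_eqI antisym)
  fix p
  have cd: "c + d > 0" using c d by simp
  show "up (pos_scale (c + d) f) p \<le> up (pos_scale c f + pos_scale d f) p"
  proof (rule up_pos_scale_leI[OF cd])
    fix r assume "of_rat p < (c + d) * of_rat r"
    then have "of_rat p - d * of_rat r < c * of_rat r" by (simp add: algebra_simps)
    then obtain t where t: "of_rat p - d * of_rat r < of_rat t" "of_rat t < c * of_rat r"
      using of_rat_dense by blast
    show "up f r \<le> up (pos_scale c f + pos_scale d f) p"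
    proof (rule le_up_addI[of t "p - t"])
      show "up f r \<le> up (pos_scale c f) t"
        using t by (intro le_up_pos_scaleI[OF c, of _ r]) auto
      show "up f r \<le> up (pos_scale d f) (p - t)"
        using t by (intro le_up_pos_scaleI[OF d, of _ r]) (auto simp: of_rat_diff)
    qed simp
  qed
  show "up (pos_scale c f + pos_scale d f) p \<le> up (pos_scale (c + d) f) p"
  proof (rule up_add_leI)
    fix r s assume rs: "r + s = p"
    have "inf (up f a) (up f b) \<le> up (pos_scale (c + d) f) p"
      if ab: "c * of_rat a > of_rat r" "d * of_rat b > of_rat s" for a b
    proof (rule le_up_pos_scaleI[OF cd])
      have "c * of_rat a \<le> c * of_rat (max a b)" "d * of_rat b \<le> d * of_rat (max a b)"
        using c d by (auto simp: of_rat_less_eq)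
      then have "(of_rat r :: real) + of_rat s < (c + d) * of_rat (max a b)"
        using ab by (simp add: distrib_right)
      then show "of_rat p < (c + d) * of_rat (max a b)" using rs by (auto simp: of_rat_add)
      show "inf (up f a) (up f b) \<le> up f (max a b)" by (auto simp: max_def)
    qed
    then show "inf (up (pos_scale c f) r) (up (pos_scale d f) s) \<le> up (pos_scale (c + d) f) p"
      unfolding up_pos_scale[OF c, of f] up_pos_scale[OF d, of f] SUP_inf inf_SUP
      by (intro SUP_least) auto
  qed
qed

lemma pos_scale_pos_scale:
  assumes c: "c > 0" and d: "d > 0"
  shows "pos_scale c (pos_scale d f) = pos_scale (c * d) (f :: 'l::frame cont)"
proof (intro cont_eqI antisym)
  fix p
  have cd: "c * d > 0" using c d by simp
  show "up (pos_scale c (pos_scale d f)) p \<le> up (pos_scale (c * d) f) p"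
  proof (intro up_pos_scale_leI[OF c] up_pos_scale_leI[OF d])
    fix r s assume "of_rat p < c * of_rat r" "of_rat r < d * of_rat s"
    moreover from this c have "c * of_rat r < c * (d * of_rat s)" by simp
    ultimately show "up f s \<le> up (pos_scale (c * d) f) p"
      by (intro le_up_pos_scaleI[OF cd, of _ s]) auto
  qed
  show "up (pos_scale (c * d) f) p \<le> up (pos_scale c (pos_scale d f)) p"
  proof (rule up_pos_scale_leI[OF cd])
    fix s assume "of_rat p < c * d * of_rat s"
    then have "of_rat p / c < d * of_rat s" using c by (simp add: field_simps)
    then obtain r where r: "of_rat p / c < of_rat r" "of_rat r < d * of_rat s" using of_rat_dense by blast
    then show "up f s \<le> up (pos_scale c (pos_scale d f)) p"
      using c by (intro le_up_pos_scaleI[OF c, of _ r] le_up_pos_scaleI[OF d, of _ s]) (auto simp: field_simps)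
  qed
qed

lemma pos_scale_one: "pos_scale 1 f = (f :: 'l::frame cont)"
proof (rule cont_eqI)
  show "up (pos_scale 1 f) p = up f p" for p
    using contD(3)[of f p] by (simp only: up_pos_scale[OF zero_less_one] mult_1 of_rat_less)
qed

lemma pos_scale_uminus:
  assumes c: "c > 0"
  shows "pos_scale c (- f) = - pos_scale c (f :: 'l::frame cont)"
proof (rule cont_eqI)
  fix p
  have "up (pos_scale c (- f)) p = (SUP r\<in>{r. c * of_rat r > of_rat p}. dn f (- r))"
    by (simp add: up_pos_scale[OF c] up_uminus)
  also have "\<dots> = (SUP r\<in>{r. c * of_rat (- r) > of_rat p}. dn f r)" by (rule SUP_uminus)
  also have "{r. c * of_rat (- r) > of_rat p} = {r. c * of_rat r < of_rat (- p)}"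
    by (auto simp: of_rat_minus)
  finally show "up (pos_scale c (- f)) p = up (- pos_scale c f) p"
    by (simp add: up_uminus dn_pos_scale[OF c])
qed

lemma pos_scale_zero: "c > 0 \<Longrightarrow> pos_scale c 0 = (0 :: 'l::frame cont)"
  using pos_scale_add[of c 0 "0 :: 'l cont"] by simp

lemma scaleR_cont_uminus: "(- c) *\<^sub>R f = - (c *\<^sub>R (f :: 'l::frame cont))"
  by (auto simp: scaleR_cont_def)

lemma scaleR_cont_nonneg_add:
  assumes "c \<ge> 0" "d \<ge> 0"
  shows "(c + d) *\<^sub>R f = c *\<^sub>R f + d *\<^sub>R (f :: 'l::frame cont)"
  using assms pos_scale_add_left[of c d f] by (auto simp: scaleR_cont_def)

instance cont :: (frame) real_vector
proof
  fix a b :: real and x y :: "'a cont"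
  show "a *\<^sub>R (x + y) = a *\<^sub>R x + a *\<^sub>R y"
    by (auto simp: scaleR_cont_def pos_scale_add)
  show "(a + b) *\<^sub>R x = a *\<^sub>R x + b *\<^sub>R x"
  proof -
    have mixed: "(a + b) *\<^sub>R x = a *\<^sub>R x + b *\<^sub>R x" if "a \<ge> 0" "b < 0" for a b
    proof (cases "a + b \<ge> 0")
      case True
      then show ?thesis
        using scaleR_cont_nonneg_add[of "a + b" "- b" x] that scaleR_cont_uminus[of b x] by simp
    next
      case False
      then show ?thesis
        using scaleR_cont_nonneg_add[of "- (a + b)" a x] that scaleR_cont_uminus[of b x]
          scaleR_cont_uminus[of "a + b" x] by (simp add: algebra_simps)
    qed
    consider "a \<ge> 0" "b \<ge> 0" | "a \<ge> 0" "b < 0" | "a < 0" "b \<ge> 0" | "a < 0" "b < 0" by linarith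
    then show ?thesis
    proof cases
      case 3
      then show ?thesis using mixed[of b a] by (simp add: add.commute)
    next
      case 4
      then have "(- a + - b) *\<^sub>R x = - (a *\<^sub>R x) + - (b *\<^sub>R x)"
        using scaleR_cont_nonneg_add[of "- a" "- b" x] by (simp only: scaleR_cont_uminus)
      moreover have "(- a + - b) *\<^sub>R x = - ((a + b) *\<^sub>R x)"
        using scaleR_cont_uminus[of "a + b" x] by (simp only: minus_add_distrib)
      ultimately have "- ((a + b) *\<^sub>R x) = - (a *\<^sub>R x + b *\<^sub>R x)"
        by (simp only: minus_add_distrib)
      then show ?thesis by (simp only: neg_equal_iff_equal)
    qed (use mixed scaleR_cont_nonneg_add in auto)
  qed
  show "a *\<^sub>R b *\<^sub>R x = (a * b) *\<^sub>R x"
    by (auto simp: scaleR_cont_def pos_scale_uminus pos_scale_pos_scale pos_scale_zero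
        mult_less_0_iff zero_less_mult_iff mult_neg_neg)
  show "1 *\<^sub>R x = x" by (simp add: scaleR_cont_def pos_scale_one)
qed

instance cont :: (frame) riesz_space
proof
  fix a b :: real and x y :: "'a cont"
  show "\<bar>x\<bar> = sup x (- x)" by (rule abs_cont_def)
  show mono: "x \<le> y \<Longrightarrow> 0 \<le> a \<Longrightarrow> a *\<^sub>R x \<le> a *\<^sub>R y" for a and x y :: "'a cont"
  proof (cases "a = 0")
    case False
    assume "x \<le> y" "0 \<le> a"
    with False have a: "a > 0" by simp
    have "up (pos_scale a x) p \<le> up (pos_scale a y) p" for p
      using \<open>x \<le> y\<close> by (intro up_pos_scale_leI[OF a] le_up_pos_scaleI[OF a]) (auto simp: less_eq_cont_def)
    with a show ?thesis by (simp add: scaleR_cont_def less_eq_cont_def)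
  qed simp
  assume "a \<le> b" "0 \<le> x"
  then have "0 \<le> (b - a) *\<^sub>R x" using mono[of 0 x "b - a"] by simp
  then show "a *\<^sub>R x \<le> b *\<^sub>R x" by (simp add: scaleR_left_diff_distrib)
qed

instance cont :: (frame) archimedean_riesz_space
proof
  fix x y :: "'a cont"
  assume x: "0 \<le> x" and n: "\<And>n. real n *\<^sub>R x \<le> y"
  have pos: "up x p = bot" if p: "p > 0" for p
  proof -
    have "inf (up x p) (dn y b) = bot" for b
    proof -
      obtain n :: nat where n0: "2 * \<bar>b\<bar> / p \<le> of_nat n" using real_arch_simple by blast
      let ?n = "Suc n"
      have "b \<le> of_nat ?n * (p / 2)"
      proof -
        have "2 * \<bar>b\<bar> \<le> of_nat n * p" using n0 p by (simp add: field_simps)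
        moreover have "0 \<le> p" using p by simp
        ultimately have "2 * b \<le> of_nat n * p + p" by linarith
        then show ?thesis by (simp add: field_simps)
      qed
      then have "up y (of_nat ?n * (p / 2)) \<le> up y b" by (rule contD(7))
      moreover have "up x p \<le> up (real ?n *\<^sub>R x) (of_nat ?n * (p / 2))"
      proof -
        have "of_rat (of_nat ?n * (p / 2)) < (of_rat (of_nat ?n * p) :: real)"
          using p by (subst of_rat_less) simp
        then have "of_rat (of_nat ?n * (p / 2)) < real ?n * of_rat p"
          by (simp add: of_rat_mult del: of_nat_Suc)
        then have "up x p \<le> up (pos_scale (real ?n) x) (of_nat ?n * (p / 2))"
          by (intro le_up_pos_scaleI[of _ _ p]) auto
        then show ?thesis by (simp add: scaleR_cont_def)
      qed
      moreover have "up (real ?n *\<^sub>R x) (of_nat ?n * (p / 2)) \<le> up y (of_nat ?n * (p / 2))"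
        using n[of ?n] by (simp only: less_eq_cont_def)
      ultimately have "up x p \<le> up y b" by order
      then have "inf (up x p) (dn y b) \<le> inf (up y b) (dn y b)" by (intro inf_mono) auto
      then show ?thesis using contD(1)[of b b y] by (simp add: le_bot)
    qed
    then have "inf (up x p) (SUP b. dn y b) = bot" unfolding inf_SUP by simp
    then show ?thesis by (simp add: contD(6))
  qed
  have "up x 0 \<le> bot" by (subst contD(3)) (simp add: pos)
  then have "up x p \<le> up 0 p" for p
    using pos[of p] contD(7)[of 0 p x] by (cases "p < 0"; cases "p = 0") (auto simp: up_zero)
  then show "x = 0" using x by (simp add: less_eq_cont_def cont_eqI antisym)
qed


section \<open>The map \<open>m\<close>\<close>

lemma principal_band_le_iff: "principal_band f \<le> B \<longleftrightarrow> f \<in> band_set B"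
  by transfer blast

lemma mem_principal_band: "f \<in> band_set (principal_band f)"
  using principal_band_le_iff[of f "principal_band f"] by simp

lemma principal_band_mono:
  assumes "0 \<le> f" "f \<le> g" shows "principal_band f \<le> principal_band g"
proof -
  have "\<bar>f\<bar> \<le> \<bar>g\<bar>" using assms by (simp add: order_trans[OF assms])
  then show ?thesis
    using is_band_solid[OF _ mem_principal_band[of g]] band_set[of "principal_band g"]
    by (simp add: principal_band_le_iff)
qed

lemma pprt_disjoint: "inf (pprt x) (pprt (- x)) = (0 :: 'a::riesz_space)"
proof -
  have "inf (pprt x) (pprt (- x)) = inf (x + pprt (- x)) (0 + pprt (- x))"
    by (subst (1) prts[of x], subst pprt_neg) simp
  also have "\<dots> = nprt x + pprt (- x)" by (simp only: add_inf_distrib_right nprt_def)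
  finally show ?thesis by (simp add: pprt_neg)
qed

lemma weak_unit_nonneg: "weak_unit e \<Longrightarrow> 0 \<le> e"
  unfolding weak_unit_def by (blast intro: order.strict_implies_order)

lemma weak_unit_disjoint:
  assumes e: "weak_unit e" and g: "inf \<bar>g\<bar> e = 0"
  shows "g = (0 :: 'a::riesz_space)"
proof -
  have "e \<in> disjoint_complement {g}"
    using g weak_unit_nonneg[OF e] by (simp add: disjoint_complement_def inf.commute)
  then have "principal_band e \<le> Abs_band (disjoint_complement {g})"
    by (simp add: principal_band_le_iff Abs_band_inverse is_band_disjoint_complement)
  then have "g \<in> disjoint_complement {g}"
    using e by (auto simp: weak_unit_def less_eq_band.rep_eq top_band.rep_eq Abs_band_inverse is_band_disjoint_complement)
  then show ?thesis using disjoint_complement_disjoint by blast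
qed

lemma weak_unit_exhausts:
  fixes e f g :: "'a::archimedean_riesz_space"
  assumes e: "weak_unit e" and g: "\<And>n. inf \<bar>g\<bar> (pprt (f + real n *\<^sub>R e)) = 0"
  shows "g = 0"
proof (rule weak_unit_disjoint[OF e])
  define k where "k = inf \<bar>g\<bar> e"
  have k: "0 \<le> k" "k \<le> \<bar>g\<bar>" "k \<le> e" using weak_unit_nonneg[OF e] by (auto simp: k_def)
  have "real n *\<^sub>R k \<le> pprt (- f)" for n
  proof -
    let ?h = "pprt (f + real n *\<^sub>R e)"
    have "inf k ?h = 0" by (rule riesz_disjoint_mono[OF g]) (use k in auto)
    then have disj: "inf (real n *\<^sub>R k) ?h = 0" by (intro riesz_disjoint_scaleR) (use k in auto)
    have nk: "0 \<le> real n *\<^sub>R k" using k by (simp add: scaleR_nonneg_nonneg)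
    have "real n *\<^sub>R k \<le> real n *\<^sub>R e" using k by (simp add: scaleR_left_mono)
    also have "real n *\<^sub>R e = (f + real n *\<^sub>R e) + (- f)" by simp
    also have "\<dots> \<le> ?h + pprt (- f)" by (intro add_mono) (simp_all add: pprt_def)
    finally have "real n *\<^sub>R k = inf (?h + pprt (- f)) (real n *\<^sub>R k)" by (simp add: inf_absorb2)
    also have "\<dots> \<le> inf ?h (real n *\<^sub>R k) + inf (pprt (- f)) (real n *\<^sub>R k)"
      using nk by (intro riesz_inf_add_le) auto
    also have "\<dots> \<le> pprt (- f)" using disj by (simp add: inf.commute)
    finally show ?thesis .
  qed
  then have "k = 0" by (rule archimedean[OF k(1)])
  then show "inf \<bar>g\<bar> e = 0" by (simp add: k_def)
qed

lemma band_eq_topI: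
  fixes B :: "'a::archimedean_riesz_space band"
  assumes "\<And>g. g \<in> band_set (- B) \<Longrightarrow> g = 0" shows "B = top"
proof -
  have "- B \<le> bot" using assms by (auto simp: less_eq_band.rep_eq bot_band.rep_eq)
  then have "- B = bot" by (rule le_bot)
  then show ?thesis by (metis compl_bot_eq double_compl)
qed

text \<open>
  \<open>riesz_m e\<close> is the map \<open>m\<close> for the weak unit \<open>e\<close>; \<open>pprt x\<close> is the positive part \<open>sup x 0\<close>.
\<close>

definition riesz_m :: "'a::archimedean_riesz_space \<Rightarrow> 'a \<Rightarrow> 'a band cont" where
  "riesz_m e f = cont_of
     (\<lambda>p. SUP r\<in>{r. r > p}. principal_band (pprt (f - of_rat r *\<^sub>R e)))
     (\<lambda>q. SUP r\<in>{r. r < q}. - principal_band (pprt (f - of_rat r *\<^sub>R e)))"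

lemma satisfies_real_rels_riesz_m:
  fixes e f :: "'a::archimedean_riesz_space"
  assumes e: "weak_unit e"
  shows "satisfies_real_rels
     (\<lambda>p. SUP r\<in>{r. r > p}. principal_band (pprt (f - of_rat r *\<^sub>R e)))
     (\<lambda>q. SUP r\<in>{r. r < q}. - principal_band (pprt (f - of_rat r *\<^sub>R e)))"
proof -
  define w where "w r = principal_band (pprt (f - of_rat r *\<^sub>R e))" for r
  have anti: "w s \<le> w r" if "r \<le> s" for r s
    unfolding w_def using that weak_unit_nonneg[OF e]
    by (intro principal_band_mono pprt_mono diff_left_mono scaleR_right_mono) (auto simp: of_rat_less_eq)
  show ?thesis
    unfolding satisfies_real_rels_def w_def[symmetric]
  proof (intro conjI allI impI)
    fix p q :: rat
    show "inf (SUP r\<in>{r. r > p}. w r) (SUP r\<in>{r. r < q}. - w r) = bot" if "p \<ge> q"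
    proof -
      have "inf (w r) (- w s) \<le> bot" if "r > p" "s < q" for r s
      proof -
        have "w r \<le> w s" using that \<open>p \<ge> q\<close> by (intro anti) simp
        then have "inf (w r) (- w s) \<le> inf (w s) (- w s)" by (intro inf_mono) auto
        then show ?thesis by simp
      qed
      then show ?thesis unfolding SUP_inf inf_SUP by (intro le_bot SUP_least) auto
    qed
    show "sup (SUP r\<in>{r. r > p}. w r) (SUP r\<in>{r. r < q}. - w r) = top" (is "?S = top") if pq: "p < q"
    proof -
      obtain r where "p < r" "r < q" using dense[OF pq] by blast
      then have "sup (w r) (- w r) \<le> ?S" by (intro sup_mono SUP_upper) auto
      then show ?thesis by (simp add: top_le)
    qed
    show "(SUP r\<in>{r. r > p}. w r) = (SUP p'\<in>{p'. p' > p}. SUP r\<in>{r. r > p'}. w r)" (is "?L = ?R")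
    proof (rule antisym)
      have "w r \<le> ?R" if r: "r > p" for r
      proof -
        obtain p' where "p < p'" "p' < r" using dense[OF r] by blast
        then show ?thesis by (intro SUP_upper2[of p'] SUP_upper2[of r]) auto
      qed
      then show "?L \<le> ?R" by (intro SUP_least) auto
      show "?R \<le> ?L" by (intro SUP_least SUP_upper) auto
    qed
    show "(SUP r\<in>{r. r < p}. - w r) = (SUP p'\<in>{p'. p' < p}. SUP r\<in>{r. r < p'}. - w r)" (is "?L = ?R")
    proof (rule antisym)
      have "- w r \<le> ?R" if r: "r < p" for r
      proof -
        obtain p' where "r < p'" "p' < p" using dense[OF r] by blast
        then show ?thesis by (intro SUP_upper2[of p'] SUP_upper2[of r]) auto
      qed
      then show "?L \<le> ?R" by (intro SUP_least) auto
      show "?R \<le> ?L" by (intro SUP_least SUP_upper) auto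
    qed
    show "(SUP p. SUP r\<in>{r. r > p}. w r) = top" (is "?B = top")
    proof (rule band_eq_topI)
      fix g assume g: "g \<in> band_set (- ?B)"
      show "g = 0"
      proof (rule weak_unit_exhausts[OF e])
        fix n
        have "w (- of_nat n) \<le> ?B"
          by (intro SUP_upper2[of "- of_nat n - 1"] SUP_upper2[of "- of_nat n"]) auto
        then have "pprt (f + real n *\<^sub>R e) \<in> band_set ?B"
          unfolding w_def principal_band_le_iff by (simp add: of_rat_minus)
        with g show "inf \<bar>g\<bar> (pprt (f + real n *\<^sub>R e)) = 0"
          by (fastforce simp: uminus_band.rep_eq disjoint_complement_def)
      qed
    qed
    show "(SUP q. SUP r\<in>{r. r < q}. - w r) = top" (is "?B = top")
    proof (rule band_eq_topI)
      fix g assume g: "g \<in> band_set (- ?B)"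
      show "g = 0"
      proof (rule weak_unit_exhausts[OF e])
        fix n
        define x where "x = pprt (- f + real n *\<^sub>R e)"
        have "- w (of_nat n) \<le> ?B"
          by (intro SUP_upper2[of "of_nat n + 1"] SUP_upper2[of "of_nat n"]) auto
        then have "- ?B \<le> w (of_nat n)" by (metis compl_le_swap2)
        with g have gw: "g \<in> band_set (w (of_nat n))" by (auto simp: less_eq_band.rep_eq)
        have "inf (pprt (f - real n *\<^sub>R e)) x = 0"
          using pprt_disjoint[of "f - real n *\<^sub>R e"] by (simp add: x_def)
        then have "pprt (f - real n *\<^sub>R e) \<in> disjoint_complement {x}"
          by (simp add: disjoint_complement_def x_def)
        then have "w (of_nat n) \<le> Abs_band (disjoint_complement {x})"
          by (simp add: w_def principal_band_le_iff Abs_band_inverse is_band_disjoint_complement)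
        with gw have "g \<in> disjoint_complement {x}"
          by (auto simp: less_eq_band.rep_eq Abs_band_inverse is_band_disjoint_complement)
        then show "inf \<bar>g\<bar> (pprt (- f + real n *\<^sub>R e)) = 0"
          by (simp add: disjoint_complement_def x_def)
      qed
    qed
  qed
qed

lemma
  assumes "weak_unit e"
  shows up_riesz_m: "up (riesz_m e f) p = (SUP r\<in>{r. r > p}. principal_band (pprt (f - of_rat r *\<^sub>R e)))"
    and dn_riesz_m: "dn (riesz_m e f) q = (SUP r\<in>{r. r < q}. - principal_band (pprt (f - of_rat r *\<^sub>R e)))"
  unfolding riesz_m_def by (rule cont_of[OF satisfies_real_rels_riesz_m[OF assms]])+

definition riesz_embedding :: "('a::riesz_space \<Rightarrow> 'b::riesz_space) \<Rightarrow> bool" where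
  "riesz_embedding h \<longleftrightarrow> linear h \<and> inj h \<and>
     (\<forall>f g. h (sup f g) = sup (h f) (h g)) \<and> (\<forall>f g. h (inf f g) = inf (h f) (h g))"

end

theory Submission
  imports Defs
begin

text \<open>
  The map \<open>m\<close> is monotone, and \<open>inf (pprt a) (pprt b) \<le> pprt (a + b)\<close> makes it superadditive. The
  bound \<open>s *\<^sub>R e \<le> pprt a + pprt (s *\<^sub>R e - a)\<close> shows that only \<open>0\<close> is disjoint from both summands,
  whence \<open>- m g \<le> m (- g)\<close>. Applying superadditivity to \<open>(f + g) + (- g)\<close> then turns
  it into additivity. In the same way \<open>c *\<^sub>R m f \<le> m (c *\<^sub>R f)\<close> for all \<open>c > 0\<close> becomes an equality
  when it is applied to \<open>1 / c\<close>. If \<open>m f = 0\<close>, then \<open>f\<close> and \<open>- f\<close> lie below every positive rational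
  multiple of \<open>e\<close>, so that \<open>f = 0\<close> by the Archimedean property.
\<close>

section \<open>Disjointness in bands and positive parts\<close>

lemma principal_band_disjoint:
  assumes "g \<in> band_set (principal_band b)" "inf \<bar>g\<bar> \<bar>b\<bar> = 0"
  shows "g = 0"
proof -
  have "b \<in> disjoint_complement {g}"
    using assms(2) by (simp add: disjoint_complement_def inf.commute)
  \<comment> \<open>The disjoint complement of \<open>{g}\<close> is a band containing
    \<open>b\<close>, so it contains the band generated by \<open>b\<close> and with it
    \<open>g\<close>, which is then disjoint from itself.\<close>
  then have "principal_band b \<le> Abs_band (disjoint_complement {g})"
    by (simp add: principal_band_le_iff Abs_band_inverse is_band_disjoint_complement)
  then have "g \<in> disjoint_complement {g}"
    using assms(1) by (auto simp: less_eq_band.rep_eq Abs_band_inverse is_band_disjoint_complement)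
  then show ?thesis using disjoint_complement_disjoint by blast
qed

text \<open>Turns inclusions of bands into elementwise checks. It rests on
  \<open>- (- B) = B\<close>, which holds because the space is Archimedean.\<close>

lemma band_le_iff_disjoint:
  fixes A B :: "'a::archimedean_riesz_space band"
  shows "A \<le> B \<longleftrightarrow> (\<forall>x \<in> band_set A \<inter> band_set (- B). x = 0)"
proof -
  have "A \<le> B \<longleftrightarrow> inf A (- B) \<le> bot" by (simp add: band_inf_bot_iff bot_unique)
  also have "\<dots> \<longleftrightarrow> (\<forall>x \<in> band_set A \<inter> band_set (- B). x = 0)"
    by (auto simp: less_eq_band.rep_eq bot_band.rep_eq inf_band.rep_eq)
  finally show ?thesis .
qed

lemma mem_uminus_principal_band:
  assumes "0 \<le> a" "x \<in> band_set (- principal_band a)"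
  shows "inf \<bar>x\<bar> a = 0"
  using assms mem_principal_band[of a] by (force simp: uminus_band.rep_eq disjoint_complement_def)

text \<open>If \<open>x\<close> lies in both bands and is disjoint from \<open>inf a b\<close>, then
  \<open>inf \<bar>x\<bar> a\<close> lies in the band of \<open>b\<close> by solidity and is
  disjoint from \<open>b\<close>, so it vanishes. Now \<open>x\<close> is disjoint from
  \<open>a\<close> while lying in the band of \<open>a\<close>.\<close>

lemma inf_principal_band_le:
  fixes a b :: "'a::archimedean_riesz_space"
  assumes a: "0 \<le> a" and b: "0 \<le> b"
  shows "inf (principal_band a) (principal_band b) \<le> principal_band (inf a b)"
  unfolding band_le_iff_disjoint
proof
  fix x assume x: "x \<in> band_set (inf (principal_band a) (principal_band b)) \<inter> band_set (- principal_band (inf a b))"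
  define z where "z = inf \<bar>x\<bar> a"
  have xa: "x \<in> band_set (principal_band a)" and xb: "x \<in> band_set (principal_band b)"
    using x by (auto simp: inf_band.rep_eq)
  have z0: "0 \<le> z" using a by (simp add: z_def)
  have "\<bar>z\<bar> \<le> \<bar>x\<bar>" using z0 by (simp add: z_def)
  then have zb: "z \<in> band_set (principal_band b)"
    using is_band_solid[OF _ xb] band_set[of "principal_band b"] by simp
  have "inf \<bar>x\<bar> (inf a b) = 0"
    using x a b by (intro mem_uminus_principal_band) auto
  then have "inf \<bar>z\<bar> \<bar>b\<bar> = 0" using z0 b by (simp add: z_def inf.assoc)
  with zb have "z = 0" by (rule principal_band_disjoint)
  then show "x = 0" using xa a by (intro principal_band_disjoint[of x a]) (simp_all add: z_def)
qed

lemma principal_band_scaleR_le: "principal_band (c *\<^sub>R a) \<le> principal_band a"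
  using is_band_subspace[of "band_set (principal_band a)"] band_set[of "principal_band a"]
  by (simp add: principal_band_le_iff mem_principal_band subspace_scale)

text \<open>The left side is disjoint from the negative parts of \<open>a\<close> and
  \<open>b\<close>, but it is bounded by \<open>pprt (a + b)\<close> plus these two parts. Hence
  \<open>pprt (a + b)\<close> alone already bounds it.\<close>

lemma inf_pprt_le_pprt_add:
  fixes a b :: "'a::riesz_space"
  shows "inf (pprt a) (pprt b) \<le> pprt (a + b)"
proof -
  define c where "c = inf (pprt a) (pprt b)"
  have "inf c (pprt (- a)) = 0"
    using pprt_disjoint[of a] by (rule riesz_disjoint_mono) (simp_all add: c_def)
  moreover have "inf c (pprt (- b)) = 0"
    using pprt_disjoint[of b] by (rule riesz_disjoint_mono) (simp_all add: c_def)
  ultimately have disj: "inf (pprt (- a) + pprt (- b)) c = 0"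
    by (intro riesz_disjoint_add) (simp_all add: c_def inf.commute)
  have "c \<le> pprt a + pprt b" by (rule order_trans[of _ "pprt a"]) (simp_all add: c_def)
  also have "\<dots> = (a + b) + (pprt (- a) + pprt (- b))"
    using prts[of a] prts[of b] by (simp add: pprt_neg algebra_simps)
  also have "\<dots> \<le> pprt (a + b) + (pprt (- a) + pprt (- b))"
    by (intro add_right_mono) (simp add: pprt_def)
  finally have "c = inf (pprt (a + b) + (pprt (- a) + pprt (- b))) c" by (simp add: inf_absorb2)
  also have "\<dots> \<le> inf (pprt (a + b)) c + inf (pprt (- a) + pprt (- b)) c"
    by (intro riesz_inf_add_le) (simp_all add: c_def)
  also have "\<dots> \<le> pprt (a + b)" using disj by simp
  finally show ?thesis by (simp add: c_def)
qed

lemma pprt_scaleR: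
  fixes x :: "'a::riesz_space"
  assumes "0 < c" shows "pprt (c *\<^sub>R x) = c *\<^sub>R pprt x"
proof (rule antisym)
  have le: "pprt (d *\<^sub>R y) \<le> d *\<^sub>R pprt y" if "0 < d" for d and y :: 'a
    using that by (simp add: pprt_def scaleR_left_mono scaleR_nonneg_nonneg)
  show "pprt (c *\<^sub>R x) \<le> c *\<^sub>R pprt x" by (rule le[OF assms])
  \<comment> \<open>The reverse inequality is \<open>le\<close> for the scalar
    \<open>inverse c\<close> at \<open>c *\<^sub>R x\<close>, multiplied by
    \<open>c\<close>.\<close>
  have "c *\<^sub>R pprt (inverse c *\<^sub>R c *\<^sub>R x) \<le> c *\<^sub>R inverse c *\<^sub>R pprt (c *\<^sub>R x)"
    using assms by (intro scaleR_left_mono le) auto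
  then show "c *\<^sub>R pprt x \<le> pprt (c *\<^sub>R x)" using assms by simp
qed

section \<open>Monotonicity and additivity of \<open>riesz_m e\<close>\<close>

context
  fixes e :: "'a::archimedean_riesz_space"
  assumes e: "weak_unit e"
begin

lemma up_riesz_m_leI:
  assumes "\<And>r. p < r \<Longrightarrow> principal_band (pprt (f - of_rat r *\<^sub>R e)) \<le> x"
  shows "up (riesz_m e f) p \<le> x"
  unfolding up_riesz_m[OF e] by (intro SUP_least assms) simp

lemma le_up_riesz_mI:
  assumes "p < r" "x \<le> principal_band (pprt (f - of_rat r *\<^sub>R e))"
  shows "x \<le> up (riesz_m e f) p"
  unfolding up_riesz_m[OF e] by (rule SUP_upper2[of r]) (use assms in auto)

lemma riesz_m_mono: "f \<le> g \<Longrightarrow> riesz_m e f \<le> riesz_m e g"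
  unfolding less_eq_cont_def
  by (intro allI up_riesz_m_leI, erule le_up_riesz_mI)
    (intro principal_band_mono pprt_mono diff_right_mono; simp)

lemma riesz_m_superadditive: "riesz_m e f + riesz_m e g \<le> riesz_m e (f + g)"
  unfolding less_eq_cont_def
proof (intro allI up_add_leI)
  fix p r s :: rat assume rs: "r + s = p"
  \<comment> \<open>By the frame law it suffices to compare single members of the two suprema; their
    thresholds \<open>r'\<close> and \<open>s'\<close> add up to a threshold above
    \<open>p\<close>.\<close>
  have "inf (principal_band (pprt (f - of_rat r' *\<^sub>R e))) (principal_band (pprt (g - of_rat s' *\<^sub>R e)))
      \<le> up (riesz_m e (f + g)) p" (is "inf (principal_band ?a) (principal_band ?b) \<le> _")
    if "r < r'" "s < s'" for r' s'
  proof (rule le_up_riesz_mI)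
    show "p < r' + s'" using that rs by auto
    have "inf (principal_band ?a) (principal_band ?b) \<le> principal_band (inf ?a ?b)"
      by (rule inf_principal_band_le) auto
    also have "\<dots> \<le> principal_band (pprt (f + g - of_rat (r' + s') *\<^sub>R e))"
      using inf_pprt_le_pprt_add[of "f - of_rat r' *\<^sub>R e" "g - of_rat s' *\<^sub>R e"]
      by (intro principal_band_mono) (simp_all add: of_rat_add algebra_simps)
    finally show "inf (principal_band ?a) (principal_band ?b) \<le> \<dots>" .
  qed
  then show "inf (up (riesz_m e f) r) (up (riesz_m e g) s) \<le> up (riesz_m e (f + g)) p"
    unfolding up_riesz_m[OF e, of f] up_riesz_m[OF e, of g] SUP_inf inf_SUP
    by (intro SUP_least) auto
qed

lemma uminus_riesz_m_le: "- riesz_m e g \<le> riesz_m e (- g)"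
  unfolding less_eq_cont_def
proof
  fix p :: rat
  have "- principal_band (pprt (g - of_rat r *\<^sub>R e)) \<le> up (riesz_m e (- g)) p" if r: "r < - p" for r
  proof -
    have "p < - r" using r by simp
    \<comment> \<open>\<open>t\<close> has to exceed \<open>p\<close> to be a threshold for
      \<open>up\<close> at \<open>p\<close>, and the gap below \<open>- r\<close> makes the scalar
      \<open>c\<close> positive.\<close>
    then obtain t where t: "p < t" "t < - r" using dense by blast
    let ?a = "pprt (g - of_rat r *\<^sub>R e)" and ?b = "pprt (- g - of_rat t *\<^sub>R e)"
    have "- principal_band ?a \<le> principal_band ?b"
      unfolding band_le_iff_disjoint
    proof
      fix x assume x: "x \<in> band_set (- principal_band ?a) \<inter> band_set (- principal_band ?b)"
      define c :: real where "c = of_rat (- r - t)"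
      have c: "0 < c" using t(2) by (simp add: c_def)
      \<comment> \<open>Adding the two arguments cancels \<open>g\<close> and leaves a multiple of
        \<open>e\<close>; anything disjoint from both positive parts is then disjoint from
        \<open>e\<close>.\<close>
      have "c *\<^sub>R e = (g - of_rat r *\<^sub>R e) + (- g - of_rat t *\<^sub>R e)"
        by (simp add: c_def of_rat_diff of_rat_minus algebra_simps)
      also have "\<dots> \<le> ?a + ?b" by (intro add_mono) (simp_all add: pprt_def)
      finally have "e \<le> inverse c *\<^sub>R (?a + ?b)"
        using c scaleR_left_mono[of "c *\<^sub>R e" "?a + ?b" "inverse c"] by simp
      moreover have "inf (inverse c *\<^sub>R (?a + ?b)) \<bar>x\<bar> = 0"
        using x mem_uminus_principal_band[of ?a x] mem_uminus_principal_band[of ?b x] c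
        by (intro riesz_disjoint_scaleR riesz_disjoint_add) (simp_all add: inf.commute)
      ultimately have "inf e \<bar>x\<bar> = 0"
        using weak_unit_nonneg[OF e] by (rule riesz_disjoint_mono[rotated 3]) auto
      then show "x = 0" using weak_unit_disjoint[OF e, of x] by (simp add: inf.commute)
    qed
    with t(1) show ?thesis by (rule le_up_riesz_mI)
  qed
  then show "up (- riesz_m e g) p \<le> up (riesz_m e (- g)) p"
    unfolding up_uminus dn_riesz_m[OF e] by (intro SUP_least) auto
qed

lemma riesz_m_uminus: "riesz_m e (- f) = - riesz_m e f"
proof (rule antisym[OF _ uminus_riesz_m_le])
  \<comment> \<open>Superadditivity at \<open>0\<close> and \<open>0\<close>, with one copy of
    \<open>riesz_m e 0\<close> cancelled.\<close>
  have "riesz_m e 0 \<le> 0" using riesz_m_superadditive[of 0 0] by simp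
  moreover have "riesz_m e f + riesz_m e (- f) \<le> riesz_m e 0"
    using riesz_m_superadditive[of f "- f"] by simp
  ultimately have "riesz_m e f + riesz_m e (- f) \<le> 0" by order
  then have "- riesz_m e f + (riesz_m e f + riesz_m e (- f)) \<le> - riesz_m e f + 0"
    by (rule add_left_mono)
  then show "riesz_m e (- f) \<le> - riesz_m e f" by simp
qed

lemma riesz_m_add: "riesz_m e (f + g) = riesz_m e f + riesz_m e g"
proof (rule antisym[OF _ riesz_m_superadditive])
  have "riesz_m e (f + g) + - riesz_m e g \<le> riesz_m e f"
    using riesz_m_superadditive[of "f + g" "- g"] by (simp add: riesz_m_uminus)
  then show "riesz_m e (f + g) \<le> riesz_m e f + riesz_m e g"
    by (simp add: diff_le_eq)
qed

section \<open>Scalar multiples and linearity\<close>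

lemma scaleR_riesz_m_le:
  assumes c: "0 < c" shows "c *\<^sub>R riesz_m e f \<le> riesz_m e (c *\<^sub>R f)"
proof -
  have "up (pos_scale c (riesz_m e f)) p \<le> up (riesz_m e (c *\<^sub>R f)) p" for p
  proof (intro up_pos_scale_leI[OF c] up_riesz_m_leI)
    fix r r' assume r: "of_rat p < c * of_rat r" and r': "r < r'"
    have "c * of_rat r < c * of_rat r'" using c r' by (simp add: of_rat_less)
    then have "of_rat p < c * of_rat r'" using r by linarith
    \<comment> \<open>\<open>c * of_rat r'\<close> may be irrational and so no admissible threshold.
      A smaller rational \<open>t\<close> is one, and lowering the threshold only enlarges the
      band.\<close>
    then obtain t where t: "of_rat p < (of_rat t :: real)" "of_rat t < c * of_rat r'"
      using of_rat_dense by blast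
    let ?a = "pprt (f - of_rat r' *\<^sub>R e)"
    have "principal_band ?a = principal_band (inverse c *\<^sub>R c *\<^sub>R ?a)" using c by simp
    also have "\<dots> \<le> principal_band (c *\<^sub>R ?a)" by (rule principal_band_scaleR_le)
    also have "c *\<^sub>R ?a = pprt (c *\<^sub>R f - (c * of_rat r') *\<^sub>R e)"
      using c by (simp add: pprt_scaleR[symmetric] scaleR_diff_right)
    also have "principal_band \<dots> \<le> principal_band (pprt (c *\<^sub>R f - of_rat t *\<^sub>R e))"
      using t weak_unit_nonneg[OF e]
      by (intro principal_band_mono pprt_mono diff_left_mono scaleR_right_mono) auto
    finally show "principal_band ?a \<le> up (riesz_m e (c *\<^sub>R f)) p"
      using t(1) by (intro le_up_riesz_mI[of p t]) (auto simp: of_rat_less)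
  qed
  then show ?thesis using c by (simp add: scaleR_cont_def less_eq_cont_def)
qed

lemma riesz_m_pos_scaleR:
  assumes c: "0 < c" shows "riesz_m e (c *\<^sub>R f) = c *\<^sub>R riesz_m e f"
proof (rule antisym[OF _ scaleR_riesz_m_le[OF c]])
  have "inverse c *\<^sub>R riesz_m e (c *\<^sub>R f) \<le> riesz_m e f"
    using scaleR_riesz_m_le[of "inverse c" "c *\<^sub>R f"] c by simp
  then have "c *\<^sub>R inverse c *\<^sub>R riesz_m e (c *\<^sub>R f) \<le> c *\<^sub>R riesz_m e f"
    using c by (intro scaleR_left_mono) auto
  then show "riesz_m e (c *\<^sub>R f) \<le> c *\<^sub>R riesz_m e f" using c by simp
qed

lemma linear_riesz_m: "linear (riesz_m e)"
proof (rule linearI)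
  show "riesz_m e (f + g) = riesz_m e f + riesz_m e g" for f g by (rule riesz_m_add)
  show "riesz_m e (c *\<^sub>R f) = c *\<^sub>R riesz_m e f" for c f
  proof (cases c "0 :: real" rule: linorder_cases)
    case less
    then show ?thesis using riesz_m_pos_scaleR[of "- c" "- f"] by (simp add: riesz_m_uminus)
  next
    case equal
    then show ?thesis using riesz_m_add[of 0 0] by simp
  qed (rule riesz_m_pos_scaleR)
qed

section \<open>Lattice operations\<close>

lemma riesz_m_sup: "riesz_m e (sup f g) = sup (riesz_m e f) (riesz_m e g)"
proof (rule antisym)
  show "sup (riesz_m e f) (riesz_m e g) \<le> riesz_m e (sup f g)"
    by (intro le_supI riesz_m_mono) auto
  show "riesz_m e (sup f g) \<le> sup (riesz_m e f) (riesz_m e g)"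
    unfolding less_eq_cont_def up_sup
  proof (intro allI up_riesz_m_leI)
    fix p r :: rat assume r: "p < r"
    define B where "B = sup (up (riesz_m e f) p) (up (riesz_m e g) p)"
    let ?a = "pprt (f - of_rat r *\<^sub>R e)" and ?b = "pprt (g - of_rat r *\<^sub>R e)"
    have "?a \<in> band_set B" "?b \<in> band_set B"
      unfolding principal_band_le_iff[symmetric] B_def
      by (intro le_supI1 le_up_riesz_mI[OF r] order_refl, intro le_supI2 le_up_riesz_mI[OF r] order_refl)
    \<comment> \<open>Bands are Riesz subspaces. Since translation and \<open>pprt\<close> both
      commute with \<open>sup\<close>, this element is the positive part belonging to
      \<open>sup f g\<close> at threshold \<open>r\<close>.\<close>
    then have "sup ?a ?b \<in> band_set B"
      using band_set[of B] by (simp add: is_band_def riesz_ideal_def riesz_subspace_def)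
    moreover have "sup f g - of_rat r *\<^sub>R e = sup (f - of_rat r *\<^sub>R e) (g - of_rat r *\<^sub>R e)"
      using add_sup_distrib_right[of f g "- (of_rat r *\<^sub>R e)"] by simp
    then have "pprt (sup f g - of_rat r *\<^sub>R e) = sup ?a ?b"
      by (simp add: pprt_def sup.assoc sup.left_commute)
    ultimately show "principal_band (pprt (sup f g - of_rat r *\<^sub>R e))
        \<le> sup (up (riesz_m e f) p) (up (riesz_m e g) p)"
      by (simp add: principal_band_le_iff B_def)
  qed
qed

lemma riesz_m_inf: "riesz_m e (inf f g) = inf (riesz_m e f) (riesz_m e g)"
proof -
  have "riesz_m e (- inf f g) = - inf (riesz_m e f) (riesz_m e g)"
    by (simp only: neg_inf_eq_sup riesz_m_sup riesz_m_uminus)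
  then show ?thesis by (simp only: riesz_m_uminus neg_equal_iff_equal)
qed

section \<open>Injectivity\<close>

lemma riesz_m_nonpos_imp:
  assumes "riesz_m e f \<le> 0" shows "f \<le> 0"
proof -
  have "real n *\<^sub>R pprt f \<le> e" for n
  proof -
    \<comment> \<open>The successor keeps \<open>r\<close> positive at \<open>n = 0\<close>, as a
      threshold above \<open>0\<close> must be.\<close>
    define r :: rat where "r = 1 / of_nat (Suc n)"
    have r: "0 < r" by (simp add: r_def)
    have "principal_band (pprt (f - of_rat r *\<^sub>R e)) \<le> up (riesz_m e f) 0"
      by (rule le_up_riesz_mI[OF r order_refl])
    also have "\<dots> \<le> up 0 0" using assms by (simp add: less_eq_cont_def)
    also have "\<dots> = bot" by (simp add: up_zero)
    \<comment> \<open>The generated band lies in \<open>bot\<close>, whose only element is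
      \<open>0\<close>.\<close>
    finally have "pprt (f - of_rat r *\<^sub>R e) = 0" by (simp add: principal_band_le_iff bot_band.rep_eq)
    then have "f - of_rat r *\<^sub>R e \<le> 0" by (metis pprt_def sup.cobounded1)
    then have "pprt f \<le> of_rat r *\<^sub>R e"
      using r weak_unit_nonneg[OF e] by (simp add: pprt_def scaleR_nonneg_nonneg)
    then have "real (Suc n) *\<^sub>R pprt f \<le> real (Suc n) *\<^sub>R of_rat r *\<^sub>R e"
      by (intro scaleR_left_mono) auto
    also have "\<dots> = e" by (simp add: r_def of_rat_divide of_rat_add)
    finally have "real (Suc n) *\<^sub>R pprt f \<le> e" .
    moreover have "real n *\<^sub>R pprt f \<le> real (Suc n) *\<^sub>R pprt f" by (intro scaleR_right_mono) auto
    ultimately show ?thesis by order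
  qed
  then have "pprt f = 0" by (intro archimedean[of "pprt f" e]) auto
  then show ?thesis by (metis pprt_def sup.cobounded1)
qed

lemma inj_riesz_m: "inj (riesz_m e)"
  unfolding linear_inj_iff_eq_0[OF linear_riesz_m]
proof (intro allI impI antisym)
  fix f assume f: "riesz_m e f = 0"
  show "f \<le> 0" using f by (intro riesz_m_nonpos_imp) simp
  have "- f \<le> 0" using f by (intro riesz_m_nonpos_imp) (simp add: riesz_m_uminus)
  then show "0 \<le> f" by simp
qed

end

theorem proposition7p2:
  fixes e :: "'a::archimedean_riesz_space"
  assumes "weak_unit e"
  shows "riesz_embedding (riesz_m e :: 'a \<Rightarrow> 'a band cont)"
  unfolding riesz_embedding_def
  using linear_riesz_m inj_riesz_m riesz_m_sup riesz_m_inf assms by blast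

end
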